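(* In the setting described in the context, with all standing assumptions in force, let $\{(\mathbf x_{(i,:)}^t)_{i=1}^N\}_{t\ge0}$ be generated by the block-wise algorithm. Then: (i) (consensus) $\lim_{t\to\infty}\|\mathbf x_{(i,:)}^t-\bar{\mathbf s}^t\|=0$ for every $i\in\{1,\dots,N\}$; (ii) (convergence) the sequence $\{\bar{\mathbf s}^t\}_{t\ge0}$ is bounded, and every limit point of it is a stationary solution of problem (P).
   Context: Problem. Let $N,B,d\ge1$. A vector $\mathbf x\in\mathbb R^{dB}$ is partitioned into blocks $\mathbf x=(\mathbf x_1,\dots,\mathbf x_B)$ with $\mathbf x_\ell\in\mathbb R^d$, and $\nabla_\ell$ denotes the partial gradient with respect to block $\ell$. Problem (P) is $$\min_{\mathbf x}\ U(\mathbf x)=\sum_{i=1}^Nf_i(\mathbf x)+\sum_{\ell=1}^B r_\ell(\mathbf x_\ell)\quad\text{s.t. }\mathbf x_\ell\in\mathcal K_\ell,\ \ell=1,\dots,B,$$ with $\mathcal K=\mathcal K_1\times\dots\times\mathcal K_B$. Problem assumptions: - each $\mathcal K_\ell\subseteq\mathbb R^d$ is nonempty, closed and convex; - each $f_i:\mathbb R^{dB}\to\mathbb R$ is $C^1$ on an open set containing $\mathcal K$, and $\nabla f_i$ is $L_i$-Lipschitz continuous and bounded on $\mathcal K$; - each $r_\ell:\mathbb R^d\to\mathbb R$ is convex with bounded subgradients on $\mathcal K_\ell$; - $U$ is coercive on $\mathcal K$. A point $\mathbf x^*\in\mathcal K$ is a stationary solution of (P) if $$\sum_{\ell=1}^B\Big[\big(\textstyle\sum_i\nabla_\ell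 f_i(\mathbf x^* )\big)^\top(\mathbf x_\ell-\mathbf x^*_\ell)+r_\ell(\mathbf x_\ell)-r_\ell(\mathbf x^*_\ell)\Big]\ge0\quad\text{for all }\mathbf x\in\mathcal K.$$ Network. $\mathcal G=(\{1,\dots,N\},\mathcal E)$ is a fixed, strongly connected digraph containing all self-loops. The in-neighbor set of $i$ is $\mathcal N_i=\{j:(j,i)\in\mathcal E\}$. Block selection. At each iteration $t\ge0$, agent $i$ picks $\ell_i^t\in\{1,\dots,B\}$. For each $i$ there is a finite $T_i>0$ with $\bigcup_{\tau=0}^{T_i-1}\{\ell_i^{t+\tau}\}=\{1,\dots,B\}$ for all $t\ge0$. Define $\mathcal N_{i,\ell}^t=\{j\in\mathcal N_i:\ell_j^t=\ell\}\cup\{i\}$ and $\mathcal E_\ell^t=\{(j,i)\in\mathcal E:j\in\mathcal N_{i,\ell}^t\}$. Weights. For each $\ell$ and $t$, $A_\ell^t=[a_{ij\ell}^t]$ satisfies $a_{ij\ell}^t>\kappa$ if $(j,i)\in\mathcal E_\ell^t$, $a_{ij\ell}^t=0$ otherwise (for a fixed $\kappa>0$), and $\mathbf 1^\top A_\ell^t=\mathbf 1^\top$. Surrogates. For each $i,\ell$, $\tilde f_{i,\ell}:\mathcal K_\ell\times\mathcal K\to\mathbb R$ satisfies: - $\tilde f_{i,\ell}(\cdot;\mathbf x)$ is $C^1$ and $\tau_i$-strongly convex on $\mathcal K_\ell$ uniformly in $\mathbf x\in\mathcal K$, with $\tau_i>0$; - $\nabla\tilde f_{i,\ell}(\mathbf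 x_\ell;\mathbf x)=\nabla_\ell f_i(\mathbf x)$ for all $\mathbf x\in\mathcal K$, where $\nabla\tilde f_{i,\ell}$ is the gradient in the first argument and $\mathbf x_\ell$ is the $\ell$-th block of $\mathbf x$; - $\nabla\tilde f_{i,\ell}(\mathbf z;\cdot)$ is Lipschitz continuous on $\mathcal K$ uniformly in $\mathbf z\in\mathcal K_\ell$. For $\mathbf w\in\mathcal K$ and $\mathbf g\in\mathbb R^d$ let $$\hat f_{i,\ell}(\mathbf z;\mathbf w,\mathbf g)=\tilde f_{i,\ell}(\mathbf z;\mathbf w)+(N\mathbf g-\nabla_\ell f_i(\mathbf w))^\top(\mathbf z-\mathbf w_\ell).$$ Step sizes. $0<\gamma^t\le1$, $\gamma^{t+1}\le\gamma^t$, $\sum_t\gamma^t=\infty$, $\sum_t(\gamma^t)^2<\infty$. Algorithm. Agent $i$ holds $\mathbf x_{(i,:)}^t=(\mathbf x_{(i,\ell)}^t)_\ell$, $\mathbf y_{(i,:)}^t=(\mathbf y_{(i,\ell)}^t)_\ell$ in $\mathbb R^{dB}$ and scalars $\phi_{(i,\ell)}^t$. Initialization: $\mathbf x_{(i,:)}^0\in\mathcal K$ arbitrary, $\mathbf y_{(i,:)}^0=\nabla f_i(\mathbf x_{(i,:)}^0)$, $\phi_{(i,\ell)}^0=1$. At iteration $t$, each agent $i$: - computes $\tilde{\mathbf x}_{(i,\ell_i^t)}^t=\arg\min_{\mathbf z\in\mathcal K_{\ell_i^t}}\hat f_{i,\ell_i^t}(\mathbf z;\mathbf x_{(i,:)}^t,\mathbf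 y_{(i,\ell_i^t)}^t)+r_{\ell_i^t}(\mathbf z)$; - sets $\Delta\mathbf x_{(i,\ell)}^t=\tilde{\mathbf x}_{(i,\ell)}^t-\mathbf x_{(i,\ell)}^t$ if $\ell=\ell_i^t$ and $\Delta\mathbf x_{(i,\ell)}^t=\mathbf 0$ otherwise; - for every $\ell$ updates $$\phi_{(i,\ell)}^{t+1}=\sum_{j\in\mathcal N_{i,\ell}^t}a_{ij\ell}^t\phi_{(j,\ell)}^t,\qquad \mathbf x_{(i,\ell)}^{t+1}=\sum_{j\in\mathcal N_{i,\ell}^t}\frac{a_{ij\ell}^t\phi_{(j,\ell)}^t}{\phi_{(i,\ell)}^{t+1}}\big(\mathbf x_{(j,\ell)}^t+\gamma^t\Delta\mathbf x_{(j,\ell)}^t\big),$$ $$\mathbf y_{(i,\ell)}^{t+1}=\sum_{j\in\mathcal N_{i,\ell}^t}\frac{a_{ij\ell}^t}{\phi_{(i,\ell)}^{t+1}}\Big(\phi_{(j,\ell)}^t\mathbf y_{(j,\ell)}^t+\nabla_\ell f_j(\mathbf x_{(j,:)}^{t+1})-\nabla_\ell f_j(\mathbf x_{(j,:)}^t)\Big).$$ Weighted average: $\bar{\mathbf s}^t=\frac1N\big(\sum_{i=1}^N\phi_{(i,\ell)}^t\mathbf x_{(i,\ell)}^t\big)_{\ell=1}^B$. *)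

theory Defs
  imports "HOL-Analysis.Analysis"
begin

text \<open>Vectors of R^{dB} are modelled as real^'d^'b: blocks are indexed by the finite type 'b
  (B = CARD('b)), each block lives in real^'d (d = CARD('d)). Agents are indexed by the
  finite type 'a (N = CARD('a)).\<close>

definition strongly_convex_on :: "real \<Rightarrow> 'v::real_inner set \<Rightarrow> ('v \<Rightarrow> real) \<Rightarrow> bool" where
  "strongly_convex_on c S f \<longleftrightarrow> convex_on S (\<lambda>z. f z - (c / 2) * (norm z)\<^sup>2)"

definition is_subgradient :: "('v::real_inner \<Rightarrow> real) \<Rightarrow> 'v \<Rightarrow> 'v \<Rightarrow> bool" where
  "is_subgradient r z g \<longleftrightarrow> (\<forall>y. r y \<ge> r z + inner g (y - z))"

definition coercive_on :: "'v::real_normed_vector set \<Rightarrow> ('v \<Rightarrow> real) \<Rightarrow> bool" where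
  "coercive_on S U \<longleftrightarrow> (\<forall>M. \<exists>R. \<forall>x\<in>S. norm x \<ge> R \<longrightarrow> U x \<ge> M)"

definition prod_set :: "('b::finite \<Rightarrow> (real^'d) set) \<Rightarrow> (real^'d^'b) set" where
  "prod_set Kb = {x. \<forall>l. x $ l \<in> Kb l}"

definition nbr_block :: "('a \<times> 'a) set \<Rightarrow> ('a \<Rightarrow> 'b) \<Rightarrow> 'a \<Rightarrow> 'b \<Rightarrow> 'a set" where
  "nbr_block E sel i l = {j. (j, i) \<in> E \<and> sel j = l} \<union> {i}"

definition edges_block :: "('a \<times> 'a) set \<Rightarrow> ('a \<Rightarrow> 'b) \<Rightarrow> 'b \<Rightarrow> ('a \<times> 'a) set" where
  "edges_block E sel l = {(j, i). (j, i) \<in> E \<and> j \<in> nbr_block E sel i l}"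

text \<open>Stationary solution of (P); gf i is the gradient of f i, Kb l the block constraint sets.\<close>
definition stationary :: "('a::finite \<Rightarrow> real^'d^'b \<Rightarrow> real^'d^'b) \<Rightarrow> ('b::finite \<Rightarrow> real^'d \<Rightarrow> real)
     \<Rightarrow> ('b \<Rightarrow> (real^'d) set) \<Rightarrow> real^'d^'b \<Rightarrow> bool" where
  "stationary gf r Kb xs \<longleftrightarrow> xs \<in> prod_set Kb \<and>
     (\<forall>x\<in>prod_set Kb. (\<Sum>l\<in>UNIV. inner (\<Sum>i\<in>UNIV. gf i xs $ l) (x $ l - xs $ l)
                                   + r l (x $ l) - r l (xs $ l)) \<ge> 0)"

end

theory Submission
  imports Defs
begin

text \<open>
  Blockwise, the algorithm is a perturbed consensus iteration for both the iterates and the gradient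
  trackers: after rescaling by \<open>\<Phi>\<close> the mixing matrices are row stochastic, and their products over a
  fixed number of steps are uniformly positive, hence contract the spread between the agents. The
  trackers are bounded because the gradients are, so the search directions \<open>\<Delta>\<close> are bounded and the
  perturbations of the iterates are \<open>O(\<gamma> t)\<close>, hence square summable; this passes to the disagreement of the
  iterates and then to that of the trackers. All error terms in the descent inequality are
  therefore summable, so \<open>sbar\<close> stays in a level set of the objective and \<open>\<gamma> t * (norm (\<Delta> t j l))\<^sup>2\<close> is summable.

  To reach blocks that are not selected at time \<open>t\<close>, \<open>\<Delta>\<close> is compared with the residual of the exact best
  response at \<open>sbar t\<close>, a Lipschitz function of the point. Every block is selected within a bounded
  window, so the \<open>\<gamma>\<close>-weighted squared residuals of all blocks are summable, and slow variation
  forces the residuals to \<open>0\<close>. A zero of the residual is a stationary point.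
\<close>

section \<open>Real sequences\<close>

text \<open>The step sizes are only square summable, and disagreement and tracking error inherit no
  more than that. An error may therefore enter the descent inequality only as a product of two
  square-summable factors, such as \<open>\<gamma> t\<close> times the tracking error; a term of
  first order in the disagreement alone need not be summable, which dictates the form of
  \<open>lyapunov\<close>. A second obstacle is circular: a rate for the trackers needs a bound on
  the steps of the iterates, which needs bounded directions, which need bounded trackers. A crude
  bound on the trackers, obtained before any rate is known (\<open>Y_bounded\<close>), breaks the
  circle. Thirdly, agents select blocks independently of each other, so
  \<open>\<Delta> t j l\<close> jumps to zero whenever \<open>l\<close> is not selected, and its
  size at one time says nothing about stationarity. The residual belongs to one agent and one block
  but is evaluated at the common point \<open>sbar t\<close>, whose increments carry no disagreement
  term. The residuals of a single agent suffice in the end, because its own gradient cancels from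
  its subproblem at a fixed point.\<close>

lemma summable_of_delayed_contraction:
  fixes a b :: "nat \<Rightarrow> real"
  assumes a: "\<And>t. 0 \<le> a t" and b: "\<And>t. 0 \<le> b t" "summable b" and q: "q < 1"
    and rec: "\<And>t. a (t + P) \<le> q * a t + b t"
  shows "summable a"
proof (rule summableI_nonneg_bounded)
  fix n
  \<comment> \<open>Summing the recursion over \<open>t < n\<close> compares a partial sum with its
    own shift by \<open>P\<close>. Only the first \<open>P\<close> terms escape, so the partial sum
    can be solved for.\<close>
  have split: "sum a {..<n + P} = sum a {..<P} + (\<Sum>t<n. a (t + P))"
    by (induction n) auto
  have "sum a {..<n} \<le> sum a {..<n + P}"
    by (rule sum_mono2) (auto simp: a)
  also have "\<dots> \<le> sum a {..<P} + (\<Sum>t<n. q * a t + b t)"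
    unfolding split by (intro add_left_mono sum_mono rec)
  also have "\<dots> = sum a {..<P} + q * sum a {..<n} + sum b {..<n}"
    by (simp add: sum.distrib sum_distrib_left)
  also have "\<dots> \<le> sum a {..<P} + q * sum a {..<n} + suminf b"
    using sum_le_suminf[OF b(2), of "{..<n}"] b(1) by auto
  finally have "(1 - q) * sum a {..<n} \<le> sum a {..<P} + suminf b"
    by (simp add: algebra_simps)
  then show "sum a {..<n} \<le> (sum a {..<P} + suminf b) / (1 - q)"
    using q by (simp add: pos_le_divide_eq mult.commute)
qed (rule a)

lemma bounded_of_delayed_contraction:
  fixes a :: "nat \<Rightarrow> real"
  assumes a: "\<And>t. 0 \<le> a t" and b: "0 \<le> b" and q: "0 \<le> q" "q < 1" and P: "P > 0"
    and rec: "\<And>t. a (t + P) \<le> q * a t + b"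
  shows "\<exists>M. \<forall>t. a t \<le> M"
proof -
  \<comment> \<open>\<open>b / (1 - q)\<close> is the fixed point of the affine recursion; adding
    the sum over the first window makes \<open>M\<close> dominate the \<open>P\<close> starting
    values as well.\<close>
  define M where "M = sum a {..<P} + b / (1 - q)"
  have b': "b = (1 - q) * (b / (1 - q))"
    using q by simp
  have M: "q * M + b \<le> M"
  proof -
    have "0 \<le> (1 - q) * sum a {..<P}"
      using q by (intro mult_nonneg_nonneg sum_nonneg a) auto
    then have "b \<le> (1 - q) * M"
      unfolding M_def using b' by (simp add: distrib_left)
    then show ?thesis by (simp add: algebra_simps)
  qed
  have "a t \<le> M" for t
  proof (induction t rule: less_induct)
    case (less t)
    show ?case
    proof (cases "t < P")
      case True
      have "a t \<le> sum a {..<P}"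
        by (rule member_le_sum) (use True a in auto)
      also have "\<dots> \<le> M"
        unfolding M_def using b q by simp
      finally show ?thesis .
    next
      case False
      then obtain s where s: "t = s + P"
        by (metis add.commute le_Suc_ex not_less)
      then have "a t \<le> q * a s + b"
        using rec by simp
      also have "\<dots> \<le> q * M + b"
        using less.IH[of s] s P q by (simp add: mult_left_mono)
      finally show ?thesis using M by simp
    qed
  qed
  then show ?thesis by blast
qed

text \<open>The increments of the cubes \<open>a t ^ 3\<close> are dominated by the two summable series, so the cubes
  converge; a positive limit would make \<open>\<gamma>\<close> summable.\<close>

lemma tendsto_zero_of_weighted_square_summable:
  fixes a \<gamma> :: "nat \<Rightarrow> real"
  assumes a: "\<And>t. 0 \<le> a t" and \<gamma>: "\<And>t. 0 \<le> \<gamma> t" "\<And>t. \<gamma> t \<le> 1"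
    and div: "\<not> summable \<gamma>" and sq: "summable (\<lambda>t. (\<gamma> t)\<^sup>2)"
    and wsq: "summable (\<lambda>t. \<gamma> t * (a t)\<^sup>2)"
    and inc: "\<And>t. \<bar>a (Suc t) - a t\<bar> \<le> M * \<gamma> t"
  shows "a \<longlonglongrightarrow> 0"
proof -
  have M: "0 \<le> M"
  proof (rule ccontr)
    assume "\<not> 0 \<le> M"
    then have "\<gamma> t = 0" for t
      using inc[of t] \<gamma>(1)[of t] by (smt (verit) mult_neg_pos)
    then have "\<gamma> = (\<lambda>t. 0)" by blast
    then show False using div by simp
  qed
  \<comment> \<open>The cube is the power whose increment, under a change of order
    \<open>\<gamma> t\<close> in \<open>a\<close>, has leading term of order
    \<open>\<gamma> t * (a t)\<^sup>2\<close>, which is exactly the given summable weight; the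
    remaining terms carry \<open>(\<gamma> t)\<^sup>2\<close>.\<close>
  define c where "c t = a t ^ 3" for t
  have "summable (\<lambda>t. c (Suc t) - c t)"
  proof (rule summable_comparison_test')
    show "summable (\<lambda>t. (3 * M + 3 * M\<^sup>2) * (\<gamma> t * (a t)\<^sup>2) + (3 * M\<^sup>2 + M ^ 3) * (\<gamma> t)\<^sup>2)"
      by (intro summable_add summable_mult wsq sq)
    fix t
    let ?a = "a t" and ?b = "a (Suc t)" and ?g = "\<gamma> t"
    have g: "0 \<le> ?g" "?g \<le> 1" and Mg: "0 \<le> M * ?g" using \<gamma> M by auto
    have b: "?b \<le> ?a + M * ?g" using inc[of t] by linarith
    have "c (Suc t) - c t = (?b - ?a) * (?b\<^sup>2 + ?b * ?a + ?a\<^sup>2)"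
      unfolding c_def by (simp add: power2_eq_square power3_eq_cube algebra_simps)
    then have "norm (c (Suc t) - c t) = \<bar>?b - ?a\<bar> * (?b\<^sup>2 + ?b * ?a + ?a\<^sup>2)"
      using a[of t] a[of "Suc t"] by (simp add: abs_mult)
    also have "\<dots> \<le> (M * ?g) * ((?a + M * ?g)\<^sup>2 + (?a + M * ?g) * ?a + ?a\<^sup>2)"
    proof (rule mult_mono[OF inc])
      have "?b\<^sup>2 \<le> (?a + M * ?g)\<^sup>2" by (rule power_mono[OF b a])
      moreover have "?b * ?a \<le> (?a + M * ?g) * ?a" by (rule mult_right_mono[OF b a])
      ultimately show "?b\<^sup>2 + ?b * ?a + ?a\<^sup>2 \<le> (?a + M * ?g)\<^sup>2 + (?a + M * ?g) * ?a + ?a\<^sup>2" by simp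
      show "0 \<le> ?b\<^sup>2 + ?b * ?a + ?a\<^sup>2" using a[of t] a[of "Suc t"] by simp
    qed (rule Mg)
    also have "\<dots> = 3 * M * (?g * ?a\<^sup>2) + 3 * M\<^sup>2 * (?g\<^sup>2 * ?a) + M ^ 3 * (?g\<^sup>2 * ?g)"
      by (simp add: power2_eq_square power3_eq_cube algebra_simps)
    also have "\<dots> \<le> 3 * M * (?g * ?a\<^sup>2) + 3 * M\<^sup>2 * (?g\<^sup>2 + ?g * ?a\<^sup>2) + M ^ 3 * ?g\<^sup>2"
    proof (intro add_mono mult_left_mono order_refl)
      \<comment> \<open>The mixed term \<open>?g\<^sup>2 * ?a\<close> matches neither series; this
        bound splits it between the two.\<close>
      have "?a \<le> 1 + ?a\<^sup>2"
        using zero_le_power2[of "?a - 1"] a[of t] by (simp add: power2_diff)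
      then have "?g\<^sup>2 * ?a \<le> ?g\<^sup>2 * (1 + ?a\<^sup>2)"
        by (rule mult_left_mono) simp
      also have "\<dots> = ?g\<^sup>2 + ?g\<^sup>2 * ?a\<^sup>2"
        by (simp add: distrib_left)
      also have "?g\<^sup>2 * ?a\<^sup>2 \<le> ?g * ?a\<^sup>2"
        using g by (intro mult_right_mono) (auto simp: power2_eq_square mult_left_le)
      finally show "?g\<^sup>2 * ?a \<le> ?g\<^sup>2 + ?g * ?a\<^sup>2" by simp
      show "?g\<^sup>2 * ?g \<le> ?g\<^sup>2" using g by (simp add: mult_left_le)
    qed (use M g in auto)
    also have "\<dots> = (3 * M + 3 * M\<^sup>2) * (?g * ?a\<^sup>2) + (3 * M\<^sup>2 + M ^ 3) * ?g\<^sup>2"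
      by (simp add: algebra_simps)
    finally show "norm (c (Suc t) - c t) \<le> \<dots>" .
  qed
  then have "(\<lambda>n. \<Sum>t<n. c (Suc t) - c t) \<longlonglongrightarrow> (\<Sum>t. c (Suc t) - c t)"
    by (rule summable_LIMSEQ)
  then have "(\<lambda>n. (c n - c 0) + c 0) \<longlonglongrightarrow> (\<Sum>t. c (Suc t) - c t) + c 0"
    unfolding sum_lessThan_telescope by (intro tendsto_intros)
  then obtain L where "c \<longlonglongrightarrow> L" by auto
  then have "(\<lambda>t. root 3 (c t)) \<longlonglongrightarrow> root 3 L"
    by (rule tendsto_real_root)
  then have lim: "a \<longlonglongrightarrow> root 3 L"
    using a by (simp add: c_def real_root_power_cancel)
  have "root 3 L = 0"
  proof (rule ccontr)
    assume "root 3 L \<noteq> 0"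
    moreover have "0 \<le> root 3 L"
      using lim a by (intro LIMSEQ_le_const) auto
    ultimately have m: "0 < root 3 L" by simp
    then have "\<forall>\<^sub>F t in sequentially. a t > root 3 L / 2"
      using lim by (intro order_tendstoD(1)) auto
    then have "\<forall>\<^sub>F t in sequentially. norm (\<gamma> t) \<le> 1 / (root 3 L / 2)\<^sup>2 * (\<gamma> t * (a t)\<^sup>2)"
    proof (rule eventually_mono)
      fix t assume "a t > root 3 L / 2"
      then have "(root 3 L / 2)\<^sup>2 \<le> (a t)\<^sup>2" using m by (intro power_mono) auto
      then have "\<gamma> t * (root 3 L / 2)\<^sup>2 \<le> \<gamma> t * (a t)\<^sup>2" using \<gamma> by (intro mult_left_mono) auto
      then have "\<gamma> t \<le> \<gamma> t * (a t)\<^sup>2 / (root 3 L / 2)\<^sup>2" using m by (subst pos_le_divide_eq) auto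
      then show "norm (\<gamma> t) \<le> 1 / (root 3 L / 2)\<^sup>2 * (\<gamma> t * (a t)\<^sup>2)" using \<gamma> by simp
    qed
    then have "summable \<gamma>"
      by (rule summable_comparison_test_ev) (intro summable_mult wsq)
    then show False using div by simp
  qed
  then show ?thesis using lim by simp
qed

section \<open>Square-summable sequences\<close>

lemma square_summable_cmult:
  fixes a :: "nat \<Rightarrow> real"
  shows "summable (\<lambda>t. (a t)\<^sup>2) \<Longrightarrow> summable (\<lambda>t. (c * a t)\<^sup>2)"
  by (simp add: power_mult_distrib summable_mult)

lemma square_summable_sum:
  fixes a :: "'i \<Rightarrow> nat \<Rightarrow> real"
  assumes "\<And>i. i \<in> I \<Longrightarrow> summable (\<lambda>t. (a i t)\<^sup>2)"
  shows "summable (\<lambda>t. (\<Sum>i\<in>I. a i t)\<^sup>2)"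
proof (rule summable_comparison_test')
  show "summable (\<lambda>t. (\<Sum>i\<in>I. (a i t)\<^sup>2) * card I)"
    by (intro summable_mult2 summable_sum assms)
  show "norm ((\<Sum>i\<in>I. a i t)\<^sup>2) \<le> (\<Sum>i\<in>I. (a i t)\<^sup>2) * card I" for t
    using sum_squared_le_sum_of_squares[of "\<lambda>i. a i t" I] by simp
qed

lemma square_summable_add:
  fixes a b :: "nat \<Rightarrow> real"
  assumes "summable (\<lambda>t. (a t)\<^sup>2)" "summable (\<lambda>t. (b t)\<^sup>2)"
  shows "summable (\<lambda>t. (a t + b t)\<^sup>2)"
  using square_summable_sum[of UNIV "\<lambda>i. if i then a else b"] assms by (simp add: UNIV_bool add.commute)

lemma summable_mult_of_squares:
  fixes a b :: "nat \<Rightarrow> real"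
  assumes "summable (\<lambda>t. (a t)\<^sup>2)" "summable (\<lambda>t. (b t)\<^sup>2)"
  shows "summable (\<lambda>t. a t * b t)"
proof (rule summable_comparison_test')
  show "summable (\<lambda>t. (a t)\<^sup>2 + (b t)\<^sup>2)" by (intro summable_add assms)
  show "norm (a t * b t) \<le> (a t)\<^sup>2 + (b t)\<^sup>2" for t
  proof -
    have "2 * (\<bar>a t\<bar> * \<bar>b t\<bar>) \<le> (a t)\<^sup>2 + (b t)\<^sup>2"
      using zero_le_power2[of "\<bar>a t\<bar> - \<bar>b t\<bar>"] by (simp add: power2_diff)
    then show ?thesis using abs_ge_zero[of "a t * b t"] unfolding real_norm_def abs_mult by linarith
  qed
qed

lemma tendsto_zero_of_square_summable:
  fixes a :: "nat \<Rightarrow> real"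
  assumes "summable (\<lambda>t. (a t)\<^sup>2)"
  shows "a \<longlonglongrightarrow> 0"
  using summable_LIMSEQ_zero[OF assms] by simp

text \<open>A deterministic form of the Robbins-Siegmund argument. The first conclusion later yields
  the summability of the weighted directions, the second keeps the averages in a level set.\<close>

lemma summable_of_descent:
  fixes V w e :: "nat \<Rightarrow> real"
  assumes V: "\<And>t. V (Suc t) \<le> V t - w t + e t" "\<And>t. m \<le> V t"
    and e: "summable e" "\<And>t. 0 \<le> e t" and w: "\<And>t. 0 \<le> w t"
  shows "summable w" "V t \<le> V 0 + suminf e"
proof -
  have *: "V n + sum w {..<n} \<le> V 0 + suminf e" for n
  proof -
    have "V n + sum w {..<n} \<le> V 0 + sum e {..<n}"
    proof (induction n)
      case (Suc n) then show ?case using V(1)[of n] by simp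
    qed simp
    also have "sum e {..<n} \<le> suminf e" using sum_le_suminf[OF e(1), of "{..<n}"] e(2) by simp
    finally show ?thesis by simp
  qed
  show "summable w"
  proof (rule summableI_nonneg_bounded[OF w])
    show "sum w {..<n} \<le> V 0 + suminf e - m" for n using *[of n] V(2)[of n] by simp
  qed
  show "V t \<le> V 0 + suminf e" using *[of t] sum_nonneg[of "{..<t}" w] w by simp
qed

section \<open>Perturbed consensus\<close>

lemma norm_convex_combination_diff_le:
  fixes u :: "'a::finite \<Rightarrow> 'v::real_normed_vector"
  assumes p: "\<And>j. 0 \<le> p j" "sum p UNIV = 1" and d: "\<And>j. norm (u j - x) \<le> d"
  shows "norm ((\<Sum>j\<in>UNIV. p j *\<^sub>R u j) - x) \<le> d"
proof -
  have "(\<Sum>j\<in>UNIV. p j *\<^sub>R u j) - x = (\<Sum>j\<in>UNIV. p j *\<^sub>R (u j - x))"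
    using p(2) by (simp add: scaleR_diff_right sum_subtractf flip: scaleR_left.sum)
  also have "norm \<dots> \<le> (\<Sum>j\<in>UNIV. p j * d)"
    using p d by (intro sum_norm_le) (auto intro: mult_left_mono)
  also have "\<dots> = d" using p(2) by (simp flip: sum_distrib_right)
  finally show ?thesis .
qed

lemma norm_convex_combinations_diff_le:
  fixes u :: "'a::finite \<Rightarrow> 'v::real_normed_vector"
  assumes p: "\<And>j. 0 \<le> p j" "sum p UNIV = 1" and q: "\<And>j. 0 \<le> q j" "sum q UNIV = 1"
    and d: "\<And>j k. norm (u j - u k) \<le> d"
  shows "norm ((\<Sum>j\<in>UNIV. p j *\<^sub>R u j) - (\<Sum>k\<in>UNIV. q k *\<^sub>R u k)) \<le> d"
proof (rule norm_convex_combination_diff_le[OF p])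
  fix j
  have "norm ((\<Sum>k\<in>UNIV. q k *\<^sub>R u k) - u j) \<le> d"
    by (rule norm_convex_combination_diff_le[OF q d])
  then show "norm (u j - (\<Sum>k\<in>UNIV. q k *\<^sub>R u k)) \<le> d"
    by (simp add: norm_minus_commute)
qed

text \<open>The diameter of the agents' values. Unlike the distance to a mean it refers to no
  weights, which change with time here, and no row-stochastic mixing increases it.\<close>

definition spread :: "('a::finite \<Rightarrow> 'v::real_normed_vector) \<Rightarrow> real" where
  "spread u = Max (range (\<lambda>(i, j). norm (u i - u j)))"

lemma norm_diff_le_spread: "norm (u i - u j) \<le> spread u"
  unfolding spread_def by (rule Max_ge) (auto intro!: rev_image_eqI[of "(i, j)"])

lemma spread_le: "(\<And>i j. norm (u i - u j) \<le> d) \<Longrightarrow> spread u \<le> d"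
  unfolding spread_def by auto

lemma spread_nonneg [simp]: "0 \<le> spread u"
  using norm_diff_le_spread[of u undefined undefined] by simp

text \<open>Doeblin's argument: every row has mass at least \<open>\<delta>\<close> in the common
  column \<open>m\<close>. This part contributes the same vector to every agent and cancels in
  differences; what remains is \<open>1 - \<delta>\<close> times a mixing by the row-stochastic
  matrix \<open>R\<close>.\<close>

lemma spread_contraction:
  fixes u :: "'a::finite \<Rightarrow> 'v::real_normed_vector"
  assumes Q: "\<And>i j. 0 \<le> Q i j" "\<And>i. sum (Q i) UNIV = 1"
    and \<delta>: "\<delta> < 1" "\<And>i. \<delta> \<le> Q i m"
  shows "spread (\<lambda>i. \<Sum>j\<in>UNIV. Q i j *\<^sub>R u j) \<le> (1 - \<delta>) * spread u"
proof (rule spread_le)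
  fix i k
  define R where "R i j = (Q i j - (if j = m then \<delta> else 0)) / (1 - \<delta>)" for i j
  have R: "0 \<le> R i j" "sum (R i) UNIV = 1" for i j
  proof -
    show "0 \<le> R i j" using Q(1)[of i j] \<delta>(1) \<delta>(2)[of i] by (simp add: R_def)
    have "sum (R i) UNIV = (sum (Q i) UNIV - (\<Sum>j\<in>UNIV. if j = m then \<delta> else 0)) / (1 - \<delta>)"
      unfolding R_def sum_subtractf[symmetric] sum_divide_distrib ..
    then show "sum (R i) UNIV = 1" using Q(2) \<delta>(1) by simp
  qed
  have QR: "(\<Sum>j\<in>UNIV. Q i j *\<^sub>R u j) = (1 - \<delta>) *\<^sub>R (\<Sum>j\<in>UNIV. R i j *\<^sub>R u j) + \<delta> *\<^sub>R u m" for i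
  proof -
    have "Q i j = (1 - \<delta>) * R i j + (if j = m then \<delta> else 0)" for j
      using \<delta>(1) by (simp add: R_def)
    then have "(\<Sum>j\<in>UNIV. Q i j *\<^sub>R u j)
        = (\<Sum>j\<in>UNIV. ((1 - \<delta>) * R i j + (if j = m then \<delta> else 0)) *\<^sub>R u j)"
      by presburger
    also have "\<dots> = (1 - \<delta>) *\<^sub>R (\<Sum>j\<in>UNIV. R i j *\<^sub>R u j)
        + (\<Sum>j\<in>UNIV. if j = m then \<delta> *\<^sub>R u j else 0)"
      by (simp add: scaleR_add_left sum.distrib scaleR_sum_right if_distrib[of "\<lambda>x. x *\<^sub>R _"]
          cong: if_cong)
    finally show ?thesis by simp
  qed
  have "(\<Sum>j\<in>UNIV. Q i j *\<^sub>R u j) - (\<Sum>j\<in>UNIV. Q k j *\<^sub>R u j)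
      = (1 - \<delta>) *\<^sub>R ((\<Sum>j\<in>UNIV. R i j *\<^sub>R u j) - (\<Sum>j\<in>UNIV. R k j *\<^sub>R u j))"
    unfolding QR by (simp add: scaleR_diff_right)
  moreover have "norm ((\<Sum>j\<in>UNIV. R i j *\<^sub>R u j) - (\<Sum>j\<in>UNIV. R k j *\<^sub>R u j)) \<le> spread u"
    by (intro norm_convex_combinations_diff_le R norm_diff_le_spread)
  ultimately show "norm ((\<Sum>j\<in>UNIV. Q i j *\<^sub>R u j) - (\<Sum>j\<in>UNIV. Q k j *\<^sub>R u j)) \<le> (1 - \<delta>) * spread u"
    using \<delta>(1) by simp
qed

section \<open>Products of nonnegative matrices along a strongly connected graph\<close>

primrec transition :: "(nat \<Rightarrow> 'a::finite \<Rightarrow> 'a \<Rightarrow> real) \<Rightarrow> nat \<Rightarrow> nat \<Rightarrow> 'a \<Rightarrow> 'a \<Rightarrow> real" where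
  "transition W t 0 i j = (if j = i then 1 else 0)"
| "transition W t (Suc p) i j = (\<Sum>k\<in>UNIV. W (t + p) i k * transition W t p k j)"

lemma transition_nonneg:
  assumes "\<And>t i j. 0 \<le> W t i j"
  shows "0 \<le> transition W t p i j"
  by (induction p arbitrary: i) (auto intro!: sum_nonneg mult_nonneg_nonneg assms)

lemma transition_row_sum:
  assumes "\<And>t i. sum (W t i) UNIV = 1"
  shows "sum (transition W t p i) UNIV = 1"
proof (induction p arbitrary: i)
  case (Suc p)
  have "sum (transition W t (Suc p) i) UNIV = (\<Sum>k\<in>UNIV. \<Sum>j\<in>UNIV. W (t + p) i k * transition W t p k j)"
    by (subst sum.swap) simp
  then show ?case by (simp add: Suc assms flip: sum_distrib_left)
qed simp

lemma transition_Suc_ge: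
  assumes W: "\<And>t i j. 0 \<le> W t i j"
  shows "W (t + p) i k * transition W t p k j \<le> transition W t (Suc p) i j"
  by (simp, rule member_le_sum[of k UNIV "\<lambda>k. W (t + p) i k * transition W t p k j"])
    (auto intro!: mult_nonneg_nonneg W transition_nonneg)

text \<open>A path from \<open>j\<close> to \<open>i\<close> is followed edge by edge: mass waits at
  a node through its self-loop until the next edge becomes active, at most \<open>T\<close> steps,
  and each step costs a factor \<open>\<eta>\<close>. Asking for all \<open>p \<ge> p0\<close> lets
  the induction continue from any later time and lets different pairs be aligned at one common
  length.\<close>

lemma transition_ge_power:
  fixes W :: "nat \<Rightarrow> 'a::finite \<Rightarrow> 'a \<Rightarrow> real"
  assumes W: "\<And>t i j. 0 \<le> W t i j" and \<eta>: "0 \<le> \<eta>" and loop: "\<And>t i. \<eta> \<le> W t i i"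
    and edge: "\<And>t i j. (j, i) \<in> E \<Longrightarrow> \<exists>s<T. \<eta> \<le> W (t + s) i j"
    and "(j, i) \<in> E\<^sup>*"
  shows "\<exists>p0. \<forall>t. \<forall>p\<ge>p0. \<eta> ^ p \<le> transition W t p i j"
proof -
  have persist: "\<eta> ^ p \<le> transition W t p i j" if "\<eta> ^ m \<le> transition W t m i j" "m \<le> p" for t p m i
    using that(2)
  proof (induction p rule: dec_induct)
    case (step p)
    have "\<eta> * \<eta> ^ p \<le> W (t + p) i i * transition W t p i j"
      by (intro mult_mono loop step.IH W) (use \<eta> in auto)
    also have "\<dots> \<le> transition W t (Suc p) i j" by (rule transition_Suc_ge[OF W])
    finally show ?case by simp
  qed (rule that(1))
  show ?thesis
    using \<open>(j, i) \<in> E\<^sup>*\<close>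
  proof (induction rule: rtrancl_induct)
    case base
    have "\<eta> ^ p \<le> transition W t p j j" for t p
      using persist[of 0 t j p] by simp
    then show ?case by blast
  next
    case (step k i)
    then obtain p0 where p0: "\<And>t p. p \<ge> p0 \<Longrightarrow> \<eta> ^ p \<le> transition W t p k j" by blast
    show ?case
    proof (intro exI[of _ "p0 + T"] allI impI)
      fix t p assume p: "p0 + T \<le> p"
      obtain s where s: "s < T" "\<eta> \<le> W (t + p0 + s) i k" using edge[OF step(2), of "t + p0"] by blast
      have "\<eta> * \<eta> ^ (p0 + s) \<le> W (t + (p0 + s)) i k * transition W t (p0 + s) k j"
        by (intro mult_mono p0 W) (use s \<eta> in \<open>auto simp: add.assoc\<close>)
      also have "\<dots> \<le> transition W t (Suc (p0 + s)) i j" by (rule transition_Suc_ge[OF W])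
      finally have "\<eta> ^ Suc (p0 + s) \<le> transition W t (Suc (p0 + s)) i j" by simp
      then show "\<eta> ^ p \<le> transition W t p i j" by (rule persist) (use s p in auto)
    qed
  qed
qed

lemma transition_uniformly_positive:
  fixes W :: "nat \<Rightarrow> 'a::finite \<Rightarrow> 'a \<Rightarrow> real"
  assumes W: "\<And>t i j. 0 \<le> W t i j" and \<eta>: "0 \<le> \<eta>" and loop: "\<And>t i. \<eta> \<le> W t i i"
    and edge: "\<And>t i j. (j, i) \<in> E \<Longrightarrow> \<exists>s<T. \<eta> \<le> W (t + s) i j"
    and strong: "\<And>i j. (i, j) \<in> E\<^sup>*"
  shows "\<exists>P>0. \<forall>t i j. \<eta> ^ P \<le> transition W t P i j"
proof -
  have "\<exists>p0. \<forall>t. \<forall>p\<ge>p0. \<eta> ^ p \<le> transition W t p i j" for i j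
    by (rule transition_ge_power[where E = E and T = T]) (use assms in auto)
  then obtain p0 where p0: "\<And>i j t p. p \<ge> p0 i j \<Longrightarrow> \<eta> ^ p \<le> transition W t p i j"
    by metis
  \<comment> \<open>\<open>Suc\<close> forces \<open>P > 0\<close>, also when all thresholds are 0;
    otherwise \<open>\<eta> ^ P\<close> could be 1 instead of a number below 1.\<close>
  define P where "P = Suc (Max (range (\<lambda>(i, j). p0 i j)))"
  have "p0 i j \<le> P" for i j
    unfolding P_def by (intro le_SucI Max_ge) (auto intro!: rev_image_eqI[of "(i, j)"])
  moreover have "P > 0" by (simp add: P_def)
  ultimately show ?thesis using p0 by blast
qed

text \<open>The comparison is with the unperturbed evolution \<open>v\<close> restarted from
  \<open>u t\<close>. Row-stochastic mixing does not amplify earlier perturbations, so they merely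
  add up; the factor 2 comes from the two agents whose distance is measured.\<close>

lemma spread_perturbed_consensus:
  fixes u \<epsilon> :: "nat \<Rightarrow> 'a::finite \<Rightarrow> 'v::real_normed_vector"
  assumes W: "\<And>t i j. 0 \<le> W t i j" "\<And>t i. sum (W t i) UNIV = 1"
    and \<delta>: "\<delta> < 1" "\<And>i j. \<delta> \<le> transition W t P i j"
    and u: "\<And>t i. u (Suc t) i = (\<Sum>j\<in>UNIV. W t i j *\<^sub>R (u t j + \<epsilon> t j))"
    and \<epsilon>: "\<And>t j. norm (\<epsilon> t j) \<le> e t"
  shows "spread (u (t + P)) \<le> (1 - \<delta>) * spread (u t) + 2 * (\<Sum>s<P. e (t + s))"
proof (rule spread_le)
  fix i k
  define v where "v p i = (\<Sum>j\<in>UNIV. transition W t p i j *\<^sub>R u t j)" for p i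
  have v0: "v 0 i = u t i" for i
    by (simp add: v_def if_distrib[of "\<lambda>x. x *\<^sub>R _"] cong: if_cong)
  have vSuc: "v (Suc p) i = (\<Sum>k\<in>UNIV. W (t + p) i k *\<^sub>R v p k)" for p i
  proof -
    have "v (Suc p) i = (\<Sum>j\<in>UNIV. \<Sum>k\<in>UNIV. W (t + p) i k *\<^sub>R transition W t p k j *\<^sub>R u t j)"
      by (simp add: v_def scaleR_left.sum)
    also have "\<dots> = (\<Sum>k\<in>UNIV. W (t + p) i k *\<^sub>R v p k)"
      by (subst sum.swap) (simp add: v_def scaleR_sum_right)
    finally show ?thesis .
  qed
  have uv: "norm (u (t + p) i - v p i) \<le> (\<Sum>s<p. e (t + s))" for p i
  proof (induction p arbitrary: i)
    case (Suc p)
    have "u (t + Suc p) i - v (Suc p) i = (\<Sum>j\<in>UNIV. W (t + p) i j *\<^sub>R (u (t + p) j + \<epsilon> (t + p) j - v p j)) - 0"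
      by (simp add: u vSuc scaleR_diff_right sum_subtractf)
    also have "norm \<dots> \<le> (\<Sum>s<p. e (t + s)) + e (t + p)"
    proof (intro norm_convex_combination_diff_le W)
      fix j
      have "norm (u (t + p) j - v p j + \<epsilon> (t + p) j) \<le> (\<Sum>s<p. e (t + s)) + e (t + p)"
        by (intro norm_triangle_mono Suc \<epsilon>)
      then show "norm (u (t + p) j + \<epsilon> (t + p) j - v p j - 0) \<le> (\<Sum>s<p. e (t + s)) + e (t + p)"
        by (simp add: algebra_simps)
    qed
    finally show ?case by simp
  qed (simp add: v0)
  have "norm (v P i - v P k) \<le> spread (v P)" by (rule norm_diff_le_spread)
  \<comment> \<open>Since \<open>\<delta>\<close> bounds every entry from below, any column can
    serve as the common one; hence the instance \<open>undefined\<close>.\<close>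
  also have "\<dots> \<le> (1 - \<delta>) * spread (u t)"
    using spread_contraction[of "transition W t P" \<delta> undefined "u t"] W \<delta>
    by (simp add: v_def[abs_def] transition_nonneg transition_row_sum)
  finally have "norm (v P i - v P k) \<le> (1 - \<delta>) * spread (u t)" .
  moreover have "norm (u (t + P) i - u (t + P) k)
      \<le> norm (v P i - v P k) + norm (u (t + P) i - v P i) + norm (u (t + P) k - v P k)"
    using norm_triangle_ineq[of "v P i - v P k" "u (t + P) i - v P i"]
      norm_triangle_ineq4[of "v P i - v P k + (u (t + P) i - v P i)" "u (t + P) k - v P k"] by simp
  ultimately show "norm (u (t + P) i - u (t + P) k) \<le> (1 - \<delta>) * spread (u t) + 2 * (\<Sum>s<P. e (t + s))"
    using uv[of P i] uv[of P k] by linarith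
qed

lemma
  fixes u \<epsilon> :: "nat \<Rightarrow> 'a::finite \<Rightarrow> 'v::real_normed_vector"
  assumes W: "\<And>t i j. 0 \<le> W t i j" "\<And>t i. sum (W t i) UNIV = 1"
    and \<eta>: "0 < \<eta>" "\<eta> < 1" and loop: "\<And>t i. \<eta> \<le> W t i i"
    and edge: "\<And>t i j. (j, i) \<in> E \<Longrightarrow> \<exists>s<T. \<eta> \<le> W (t + s) i j"
    and strong: "\<And>i j. (i, j) \<in> E\<^sup>*"
    and u: "\<And>t i. u (Suc t) i = (\<Sum>j\<in>UNIV. W t i j *\<^sub>R (u t j + \<epsilon> t j))"
    and \<epsilon>: "\<And>t j. norm (\<epsilon> t j) \<le> e t"
  shows perturbed_consensus_bounded: "(\<And>t. e t \<le> c) \<Longrightarrow> \<exists>M. \<forall>t. spread (u t) \<le> M"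
    and perturbed_consensus_square_summable:
      "summable (\<lambda>t. (e t)\<^sup>2) \<Longrightarrow> summable (\<lambda>t. (spread (u t))\<^sup>2)"
proof -
  obtain P where P: "P > 0" "\<And>t i j. \<eta> ^ P \<le> transition W t P i j"
    using transition_uniformly_positive[where W = W and E = E and T = T and \<eta> = \<eta>] W(1) \<eta>(1) loop edge strong
    by (metis order_less_imp_le)
  define \<delta> where "\<delta> = \<eta> ^ P"
  have \<delta>: "0 < \<delta>" "\<delta> < 1"
    using \<eta> P(1) by (auto simp: \<delta>_def power_less_one_iff)
  have e: "0 \<le> e t" for t using \<epsilon>[of t] norm_ge_zero order_trans by blast
  have contr: "spread (u (t + P)) \<le> (1 - \<delta>) * spread (u t) + 2 * (\<Sum>s<P. e (t + s))" for t
    by (rule spread_perturbed_consensus[where W = W and \<epsilon> = \<epsilon>])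
      (use W \<delta>(2) P(2) u \<epsilon> in \<open>auto simp: \<delta>_def\<close>)
  show "\<exists>M. \<forall>t. spread (u t) \<le> M" if c: "\<And>t. e t \<le> c"
  proof (rule bounded_of_delayed_contraction)
    show "0 \<le> 2 * (P * c)" using e[of 0] c[of 0] by simp
    show "spread (u (t + P)) \<le> (1 - \<delta>) * spread (u t) + 2 * (P * c)" for t
      using contr[of t] sum_bounded_above[of "{..<P}" "\<lambda>s. e (t + s)" c] c by simp
  qed (use P \<delta> in auto)
  show "summable (\<lambda>t. (spread (u t))\<^sup>2)" if e2: "summable (\<lambda>t. (e t)\<^sup>2)"
  proof (rule summable_of_delayed_contraction)
    show "summable (\<lambda>t. 4 / \<delta> * ((\<Sum>s<P. (e (t + s))\<^sup>2) * P))"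
      using e2 by (intro summable_mult summable_mult2 summable_sum summable_ignore_initial_segment)
    fix t
    define a where "a = spread (u t)"
    define b where "b = 2 * (\<Sum>s<P. e (t + s))"
    have "(spread (u (t + P)))\<^sup>2 \<le> ((1 - \<delta>) * a + b)\<^sup>2"
      using contr[of t] by (intro power_mono) (auto simp: a_def b_def)
    \<comment> \<open>Convexity of the square with weights \<open>1 - \<delta>\<close> and
      \<open>\<delta>\<close> at the points \<open>a\<close> and \<open>b / \<delta>\<close>. It
      preserves a contraction factor below 1, which the bound
      \<open>(x + y)\<^sup>2 \<le> 2 * x\<^sup>2 + 2 * y\<^sup>2\<close> might not.\<close>
    also have "\<dots> \<le> (1 - \<delta>) * a\<^sup>2 + b\<^sup>2 / \<delta>"
    proof -
      have "(1 - \<delta>) * a\<^sup>2 + b\<^sup>2 / \<delta> - ((1 - \<delta>) * a + b)\<^sup>2 = (1 - \<delta>) * (\<delta> * a - b)\<^sup>2 / \<delta>"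
        using \<delta> by (simp add: field_simps power2_eq_square)
      also have "\<dots> \<ge> 0" using \<delta> by simp
      finally show ?thesis by simp
    qed
    also have "b\<^sup>2 / \<delta> \<le> 4 / \<delta> * ((\<Sum>s<P. (e (t + s))\<^sup>2) * P)"
      using sum_squared_le_sum_of_squares[of "\<lambda>s. e (t + s)" "{..<P}"] \<delta>
      by (simp add: b_def power_mult_distrib divide_right_mono)
    finally show "(spread (u (t + P)))\<^sup>2 \<le> (1 - \<delta>) * (spread (u t))\<^sup>2 + 4 / \<delta> * ((\<Sum>s<P. (e (t + s))\<^sup>2) * P)"
      by (simp add: a_def)
  qed (use \<delta> in \<open>auto intro!: divide_nonneg_pos mult_nonneg_nonneg sum_nonneg\<close>)
qed

section \<open>Convex functions\<close>

text \<open>A hyperplane separates \<open>(z, r z)\<close> from the strict epigraph, and its normal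
  is rescaled to have vertical part 1. Existence is what gives the assumption of bounded
  subgradients its content: it becomes a Lipschitz bound for \<open>r\<close>.\<close>

lemma subgradient_exists:
  fixes r :: "'v::euclidean_space \<Rightarrow> real"
  assumes r: "convex_on UNIV r"
  shows "\<exists>g. is_subgradient r z g"
proof -
  let ?T = "{(x, s). r x < s}"
  have "convex ?T"
  proof (rule convexI, clarsimp)
    fix x y :: 'v and s t u v :: real
    assume h: "r x < s" "r y < t" "0 \<le> u" "0 \<le> v" "u + v = 1"
    have "r (u *\<^sub>R x + v *\<^sub>R y) \<le> u * r x + v * r y"
      using r h unfolding convex_on_def by blast
    also have "\<dots> < u * s + v * t"
    proof (cases "u = 0")
      case False
      then have "u * r x < u * s" using h by simp
      moreover have "v * r y \<le> v * t" using h by (simp add: mult_left_mono)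
      ultimately show ?thesis by simp
    qed (use h in simp)
    finally show "r (u *\<^sub>R x + v *\<^sub>R y) < u * s + v * t" .
  qed
  moreover have "?T \<noteq> {}" by (auto intro!: exI[of _ z] exI[of _ "r z + 1"])
  moreover have "{(z, r z)} \<inter> ?T = {}" by auto
  ultimately obtain a b where a: "a \<noteq> 0" "\<And>x. x \<in> {(z, r z)} \<Longrightarrow> inner a x \<le> b"
      "\<And>x. x \<in> ?T \<Longrightarrow> b \<le> inner a x"
    using separating_hyperplane_sets[of "{(z, r z)}" ?T] by auto
  obtain p \<alpha> where p: "a = (p, \<alpha>)" by (cases a)
  have sep: "inner p z + \<alpha> * r z \<le> inner p x + \<alpha> * s" if "r x < s" for x s
    using a(2)[of "(z, r z)"] a(3)[of "(x, s)"] that by (simp add: p)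
  have "0 \<le> \<alpha>" using sep[of z "r z + 1"] by (simp add: distrib_left)
  \<comment> \<open>A vertical hyperplane is excluded because \<open>r\<close> is finite everywhere:
    the epigraph also has points above \<open>z - p\<close>, and testing there forces
    \<open>p = 0\<close>.\<close>
  moreover have "\<alpha> \<noteq> 0"
  proof
    assume "\<alpha> = 0"
    with sep[of "z - p" "r (z - p) + 1"] have "inner p p \<le> 0" by (simp add: inner_diff_right)
    then have "p = 0" by (meson inner_eq_zero_iff inner_ge_zero order_antisym)
    with \<open>\<alpha> = 0\<close> a(1) p show False by (simp add: zero_prod_def)
  qed
  ultimately have \<alpha>: "\<alpha> > 0" by simp
  \<comment> \<open>Separation speaks only of heights strictly above \<open>r x\<close>; density of
    the reals closes the gap.\<close>
  have "r z + inner (- (1 / \<alpha>) *\<^sub>R p) (x - z) \<le> r x" for x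
  proof (rule dense_ge)
    fix s assume "r x < s"
    then have "\<alpha> * (r z + inner (- (1 / \<alpha>) *\<^sub>R p) (x - z)) \<le> \<alpha> * s"
      using sep[of x s] \<alpha> by (simp add: algebra_simps inner_diff_right)
    then show "r z + inner (- (1 / \<alpha>) *\<^sub>R p) (x - z) \<le> s" using \<alpha> by simp
  qed
  then show ?thesis unfolding is_subgradient_def by blast
qed

section \<open>First-order conditions and growth bounds\<close>

lemma GDERIV_directional:
  fixes f :: "'v::real_inner \<Rightarrow> real"
  assumes "GDERIV f (x + s *\<^sub>R v) :> p"
  shows "((\<lambda>s. f (x + s *\<^sub>R v)) has_real_derivative inner p v) (at s)"
proof -
  have "((\<lambda>s. x + s *\<^sub>R v) has_derivative (\<lambda>h. h *\<^sub>R v)) (at s)"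
    by (auto intro!: derivative_eq_intros)
  moreover have "(f has_derivative (\<lambda>h. inner h p)) (at (x + s *\<^sub>R v))"
    using assms by (simp add: gderiv_def)
  ultimately have "((\<lambda>s. f (x + s *\<^sub>R v)) has_derivative (\<lambda>h. inner (h *\<^sub>R v) p)) (at s)"
    using has_derivative_compose by blast
  then show ?thesis
    by (simp add: has_field_derivative_def inner_commute mult_commute_abs)
qed

lemma GDERIV_right_slope:
  fixes f :: "'v::real_inner \<Rightarrow> real"
  assumes "GDERIV f x :> p"
  shows "((\<lambda>s. (f (x + s *\<^sub>R v) - f x) / s) \<longlongrightarrow> inner p v) (at_right 0)"
proof -
  have "((\<lambda>s. f (x + s *\<^sub>R v)) has_real_derivative inner p v) (at_right 0)"
    using GDERIV_directional[of f x 0 v p] assms by (auto intro: DERIV_subset)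
  then show ?thesis by (simp add: has_field_derivative_iff)
qed

text \<open>Only \<open>h\<close> is differentiated. The possibly nonsmooth \<open>r\<close> is
  bounded by its chord on the segment from \<open>x\<close> to \<open>y\<close>, and then the
  segment is shrunk to \<open>x\<close>.\<close>

lemma minimizer_variational_inequality:
  fixes h r :: "'v::real_inner \<Rightarrow> real"
  assumes S: "convex S" and r: "convex_on S r" and x: "x \<in> S" and y: "y \<in> S"
    and min: "\<And>z. z \<in> S \<Longrightarrow> h x + r x \<le> h z + r z" and h: "GDERIV h x :> p"
  shows "0 \<le> inner p (y - x) + r y - r x"
proof -
  have "- (r y - r x) \<le> inner p (y - x)"
  proof (rule tendsto_lowerbound[OF GDERIV_right_slope[OF h]])
    show "\<forall>\<^sub>F s in at_right 0. - (r y - r x) \<le> (h (x + s *\<^sub>R (y - x)) - h x) / s"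
      using eventually_at_right_real[OF zero_less_one]
    proof (rule eventually_mono)
      fix s :: real assume s: "s \<in> {0<..<1}"
      have seg: "x + s *\<^sub>R (y - x) = (1 - s) *\<^sub>R x + s *\<^sub>R y" by (simp add: algebra_simps)
      have "x + s *\<^sub>R (y - x) \<in> S"
        unfolding seg by (rule convexD[OF S x y]) (use s in auto)
      then have "h x + r x \<le> h (x + s *\<^sub>R (y - x)) + r (x + s *\<^sub>R (y - x))" by (rule min)
      also have "r (x + s *\<^sub>R (y - x)) \<le> (1 - s) * r x + s * r y"
        unfolding seg by (rule convex_onD[OF r]) (use s x y in auto)
      finally have "- (r y - r x) * s \<le> h (x + s *\<^sub>R (y - x)) - h x"
        by (simp add: algebra_simps)
      then show "- (r y - r x) \<le> (h (x + s *\<^sub>R (y - x)) - h x) / s"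
        using s by (simp add: pos_le_divide_eq)
    qed
  qed simp
  then show ?thesis by simp
qed

lemma convex_on_above_tangent:
  fixes h :: "'v::real_inner \<Rightarrow> real"
  assumes h: "convex_on S h" and x: "x \<in> S" and y: "y \<in> S" and d: "GDERIV h x :> p"
  shows "h x + inner p (y - x) \<le> h y"
proof -
  have "inner p (y - x) \<le> h y - h x"
  proof (rule tendsto_upperbound[OF GDERIV_right_slope[OF d]])
    show "\<forall>\<^sub>F s in at_right 0. (h (x + s *\<^sub>R (y - x)) - h x) / s \<le> h y - h x"
      using eventually_at_right_real[OF zero_less_one]
    proof (rule eventually_mono)
      fix s :: real assume s: "s \<in> {0<..<1}"
      have "x + s *\<^sub>R (y - x) = (1 - s) *\<^sub>R x + s *\<^sub>R y" by (simp add: algebra_simps)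
      then have "h (x + s *\<^sub>R (y - x)) \<le> (1 - s) * h x + s * h y"
        using convex_onD[OF h, of s x y] s x y by auto
      then have "h (x + s *\<^sub>R (y - x)) - h x \<le> (h y - h x) * s"
        by (simp add: algebra_simps)
      then show "(h (x + s *\<^sub>R (y - x)) - h x) / s \<le> h y - h x"
        using s by (simp add: pos_divide_le_eq)
    qed
  qed simp
  then show ?thesis by simp
qed

lemma strongly_convex_on_above_tangent:
  fixes h :: "'v::real_inner \<Rightarrow> real"
  assumes h: "strongly_convex_on c S h" and x: "x \<in> S" and y: "y \<in> S" and d: "GDERIV h x :> p"
  shows "h x + inner p (y - x) + c / 2 * (norm (y - x))\<^sup>2 \<le> h y"
proof -
  have "GDERIV (\<lambda>z. h z - c / 2 * (norm z)\<^sup>2) x :> p - c *\<^sub>R x"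
    using d unfolding gderiv_def power2_norm_eq_inner
    by (auto intro!: derivative_eq_intros simp: inner_diff_right inner_commute)
  from convex_on_above_tangent[OF h[unfolded strongly_convex_on_def] x y this]
  show ?thesis
    by (simp add: power2_norm_eq_inner inner_diff_left inner_diff_right inner_commute algebra_simps)
qed

lemma strongly_convex_on_gradient_monotone:
  fixes h :: "'v::real_inner \<Rightarrow> real"
  assumes h: "strongly_convex_on c S h" and x: "x \<in> S" and y: "y \<in> S"
    and "GDERIV h x :> p" "GDERIV h y :> q"
  shows "c * (norm (x - y))\<^sup>2 \<le> inner (p - q) (x - y)"
  using strongly_convex_on_above_tangent[OF h x y assms(4)]
    strongly_convex_on_above_tangent[OF h y x assms(5)]
  by (simp add: inner_diff_left inner_diff_right norm_minus_commute)

lemma strongly_convex_minimizer_exists: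
  fixes h r :: "'v::euclidean_space \<Rightarrow> real"
  assumes S: "closed S" "S \<noteq> {}" and c: "c > 0" and h: "strongly_convex_on c S h"
    and d: "\<And>z. z \<in> S \<Longrightarrow> GDERIV h z :> p z" and r: "convex_on UNIV r"
  shows "\<exists>x\<in>S. \<forall>z\<in>S. h x + r x \<le> h z + r z"
proof -
  obtain z0 where z0: "z0 \<in> S" using S by blast
  obtain g where g: "is_subgradient r z0 g" using subgradient_exists[OF r] by blast
  \<comment> \<open>The radius beyond which the quadratic term of strong convexity outweighs the
    linear term with slope \<open>p z0 + g\<close>, so that no point outside the ball beats
    \<open>z0\<close>.\<close>
  define R where "R = 2 * norm (p z0 + g) / c"
  have "continuous_on S h"
    using d by (intro continuous_at_imp_continuous_on) (auto simp: gderiv_def dest: has_derivative_continuous)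
  moreover have "continuous_on S r"
    using convex_on_continuous[OF open_UNIV r] continuous_on_subset by blast
  ultimately have "continuous_on (S \<inter> cball z0 R) (\<lambda>z. h z + r z)"
    by (intro continuous_intros) (auto intro: continuous_on_subset)
  moreover have "compact (S \<inter> cball z0 R)" using S by (simp add: closed_Int_compact)
  moreover have z0R: "z0 \<in> S \<inter> cball z0 R" using z0 c by (simp add: R_def)
  ultimately obtain x where x: "x \<in> S \<inter> cball z0 R" "\<And>z. z \<in> S \<inter> cball z0 R \<Longrightarrow> h x + r x \<le> h z + r z"
    using continuous_attains_inf[of "S \<inter> cball z0 R"] by blast
  have "h x + r x \<le> h z + r z" if z: "z \<in> S" for z
  proof (cases "z \<in> cball z0 R")
    case False
    then have far: "R < norm (z - z0)" by (simp add: dist_norm norm_minus_commute)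
    have "h z0 + r z0 + inner (p z0 + g) (z - z0) + c / 2 * (norm (z - z0))\<^sup>2 \<le> h z + r z"
    proof -
      have "r z0 + inner g (z - z0) \<le> r z" using g by (simp add: is_subgradient_def)
      then show ?thesis
        using strongly_convex_on_above_tangent[OF h z0 z d[OF z0]] by (simp add: inner_add_left)
    qed
    moreover have "- inner (p z0 + g) (z - z0) \<le> norm (p z0 + g) * norm (z - z0)"
      using Cauchy_Schwarz_ineq2[of "p z0 + g" "z - z0"] by linarith
    moreover have "norm (p z0 + g) * norm (z - z0) \<le> c / 2 * (norm (z - z0))\<^sup>2"
    proof -
      have "norm (p z0 + g) \<le> c / 2 * norm (z - z0)"
        using far c by (simp add: R_def field_simps)
      from mult_right_mono[OF this norm_ge_zero] show ?thesis
        by (simp add: power2_eq_square mult.assoc)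
    qed
    ultimately have "h z0 + r z0 \<le> h z + r z" by linarith
    then show ?thesis using x(2)[OF z0R] by simp
  qed (use x that in auto)
  then show ?thesis using x(1) by blast
qed

text \<open>The mean value theorem gives the constant \<open>L\<close> where integration would give
  \<open>L / 2\<close>; the factor is harmless because the squared step will be summable.\<close>

lemma lipschitz_gradient_upper_bound:
  fixes h :: "'v::real_inner \<Rightarrow> real"
  assumes S: "convex S" and d: "\<And>z. z \<in> S \<Longrightarrow> GDERIV h z :> p z" and L: "L-lipschitz_on S p"
    and x: "x \<in> S" and y: "y \<in> S"
  shows "h y \<le> h x + inner (p x) (y - x) + L * (norm (y - x))\<^sup>2"
proof -
  have seg: "x + s *\<^sub>R (y - x) \<in> S" if "0 \<le> s" "s \<le> 1" for s
  proof -
    have "x + s *\<^sub>R (y - x) = (1 - s) *\<^sub>R x + s *\<^sub>R y" by (simp add: algebra_simps)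
    then show ?thesis using convexD[OF S x y, of "1 - s" s] that by simp
  qed
  have "\<exists>s. 0 < s \<and> s < 1 \<and> h (x + 1 *\<^sub>R (y - x)) - h (x + 0 *\<^sub>R (y - x))
      = (1 - 0) * inner (p (x + s *\<^sub>R (y - x))) (y - x)"
    by (intro MVT2[where f = "\<lambda>s. h (x + s *\<^sub>R (y - x))"] GDERIV_directional d seg) auto
  then obtain s where s: "0 < s" "s < 1" "h y - h x = inner (p (x + s *\<^sub>R (y - x))) (y - x)" by auto
  have "inner (p (x + s *\<^sub>R (y - x)) - p x) (y - x) \<le> norm (p (x + s *\<^sub>R (y - x)) - p x) * norm (y - x)"
    by (rule norm_cauchy_schwarz)
  also have "norm (p (x + s *\<^sub>R (y - x)) - p x) \<le> L * norm (s *\<^sub>R (y - x))"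
    using lipschitz_onD[OF L seg x] s by (simp add: dist_norm)
  also have "L * norm (s *\<^sub>R (y - x)) \<le> L * norm (y - x)"
    using s lipschitz_on_nonneg[OF L] by (intro mult_left_mono) (auto simp: mult_left_le_one_le)
  finally show ?thesis
    using s(3) by (simp add: mult_right_mono inner_diff_left power2_eq_square mult.assoc)
qed

section \<open>The algorithm\<close>

lemma uniform_constant:
  fixes P :: "'i::finite \<Rightarrow> real \<Rightarrow> bool"
  assumes ex: "\<And>i. \<exists>c. P i c" and mono: "\<And>i c c'. P i c \<Longrightarrow> c \<le> c' \<Longrightarrow> P i c'"
  shows "\<exists>c\<ge>0. \<forall>i. P i c"
proof -
  obtain c where c: "\<And>i. P i (c i)" using ex by metis
  have "c i \<le> (\<Sum>i\<in>UNIV. \<bar>c i\<bar>)" for i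
    using member_le_sum[of i UNIV "\<lambda>i. \<bar>c i\<bar>"] abs_ge_self[of "c i"] by simp
  then have "P i (\<Sum>i\<in>UNIV. \<bar>c i\<bar>)" for i using c mono by blast
  moreover have "0 \<le> (\<Sum>i\<in>UNIV. \<bar>c i\<bar>)" by (simp add: sum_nonneg)
  ultimately show ?thesis by blast
qed

lemma uniform_positive_constant:
  fixes g :: "'i::finite \<Rightarrow> real"
  assumes "\<And>i. 0 < g i"
  shows "\<exists>c>0. \<forall>i. c \<le> g i"
  using assms by (intro exI[of _ "Min (range g)"]) auto

lemma norm_vec_le_sum: "norm x \<le> (\<Sum>l\<in>UNIV. norm (x $ l))"
  unfolding norm_vec_def by (rule L2_set_le_sum) simp

locale block_gradient_tracking =
  fixes f :: "'a::finite \<Rightarrow> real^'d::finite^'b::finite \<Rightarrow> real"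
    and gf :: "'a \<Rightarrow> real^'d^'b \<Rightarrow> real^'d^'b"
    and r :: "'b \<Rightarrow> real^'d \<Rightarrow> real"
    and Kb :: "'b \<Rightarrow> (real^'d) set"
    and E :: "('a \<times> 'a) set"
    and sel :: "nat \<Rightarrow> 'a \<Rightarrow> 'b"
    and A :: "'b \<Rightarrow> nat \<Rightarrow> 'a \<Rightarrow> 'a \<Rightarrow> real"
    and \<kappa> :: real
    and ft :: "'a \<Rightarrow> 'b \<Rightarrow> real^'d \<Rightarrow> real^'d^'b \<Rightarrow> real"
    and gft :: "'a \<Rightarrow> 'b \<Rightarrow> real^'d \<Rightarrow> real^'d^'b \<Rightarrow> real^'d"
    and \<tau> :: "'a \<Rightarrow> real"
    and \<gamma> :: "nat \<Rightarrow> real"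
    and X Y :: "nat \<Rightarrow> 'a \<Rightarrow> real^'d^'b"
    and \<Phi> :: "nat \<Rightarrow> 'a \<Rightarrow> 'b \<Rightarrow> real"
    and Xt :: "nat \<Rightarrow> 'a \<Rightarrow> real^'d"
  assumes K_ne: "\<And>l. Kb l \<noteq> {}"
    and K_closed: "\<And>l. closed (Kb l)"
    and K_convex: "\<And>l. convex (Kb l)"
    and f_deriv: "\<And>i x. x \<in> prod_set Kb \<Longrightarrow> GDERIV (f i) x :> gf i x"
    and gf_lip: "\<And>i. \<exists>L. L-lipschitz_on (prod_set Kb) (gf i)"
    and gf_bdd: "\<And>i. bounded (gf i ` prod_set Kb)"
    and r_convex: "\<And>l. convex_on UNIV (r l)"
    and r_subgrad_bdd: "\<And>l. \<exists>M. \<forall>z\<in>Kb l. \<forall>g. is_subgradient (r l) z g \<longrightarrow> norm g \<le> M"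
    and U_coercive: "coercive_on (prod_set Kb) (\<lambda>x. (\<Sum>i\<in>UNIV. f i x) + (\<Sum>l\<in>UNIV. r l (x $ l)))"
    and E_strong: "\<And>i j. (i, j) \<in> E\<^sup>*"
    and E_loops: "\<And>i. (i, i) \<in> E"
    and sel_ess_cyclic: "\<And>i. \<exists>T>0. \<forall>t. (\<Union>s<T. {sel (t + s) i}) = UNIV"
    and \<kappa>_pos: "\<kappa> > 0"
    and A_pos: "\<And>l t i j. (j, i) \<in> edges_block E (sel t) l \<Longrightarrow> A l t i j > \<kappa>"
    and A_zero: "\<And>l t i j. (j, i) \<notin> edges_block E (sel t) l \<Longrightarrow> A l t i j = 0"
    and A_colstoch: "\<And>l t j. (\<Sum>i\<in>UNIV. A l t i j) = 1"
    and \<tau>_pos: "\<And>i. \<tau> i > 0"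
    and ft_deriv: "\<And>i l x z. x \<in> prod_set Kb \<Longrightarrow> z \<in> Kb l \<Longrightarrow> GDERIV (\<lambda>z. ft i l z x) z :> gft i l z x"
    and ft_strong: "\<And>i l x. x \<in> prod_set Kb \<Longrightarrow> strongly_convex_on (\<tau> i) (Kb l) (\<lambda>z. ft i l z x)"
    and ft_grad_cons: "\<And>i l x. x \<in> prod_set Kb \<Longrightarrow> gft i l (x $ l) x = gf i x $ l"
    and ft_lip: "\<And>i l. \<exists>L. \<forall>z\<in>Kb l. L-lipschitz_on (prod_set Kb) (\<lambda>x. gft i l z x)"
    and \<gamma>_pos: "\<And>t. 0 < \<gamma> t" and \<gamma>_le1: "\<And>t. \<gamma> t \<le> 1"
    and \<gamma>_decr: "\<And>t. \<gamma> (Suc t) \<le> \<gamma> t"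
    and \<gamma>_not_summable: "\<not> summable \<gamma>"
    and \<gamma>_sq_summable: "summable (\<lambda>t. (\<gamma> t)\<^sup>2)"
    and init_X: "\<And>i. X 0 i \<in> prod_set Kb"
    and init_Y: "\<And>i. Y 0 i = gf i (X 0 i)"
    and init_\<Phi>: "\<And>i l. \<Phi> 0 i l = 1"
    and Xt_mem: "\<And>t i. Xt t i \<in> Kb (sel t i)"
    and Xt_min: "\<And>t i z. z \<in> Kb (sel t i) \<Longrightarrow>
        ft i (sel t i) (Xt t i) (X t i)
          + inner (real CARD('a) *\<^sub>R (Y t i $ sel t i) - gf i (X t i) $ sel t i) (Xt t i - X t i $ sel t i)
          + r (sel t i) (Xt t i)
        \<le> ft i (sel t i) z (X t i)
          + inner (real CARD('a) *\<^sub>R (Y t i $ sel t i) - gf i (X t i) $ sel t i) (z - X t i $ sel t i)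
          + r (sel t i) z"
    and upd_\<Phi>: "\<And>t i l. \<Phi> (Suc t) i l =
        (\<Sum>j\<in>nbr_block E (sel t) i l. A l t i j * \<Phi> t j l)"
    and upd_X: "\<And>t i l. X (Suc t) i $ l =
        (\<Sum>j\<in>nbr_block E (sel t) i l. (A l t i j * \<Phi> t j l / \<Phi> (Suc t) i l) *\<^sub>R
           (X t j $ l + \<gamma> t *\<^sub>R (if l = sel t j then Xt t j - X t j $ l else 0)))"
    and upd_Y: "\<And>t i l. Y (Suc t) i $ l =
        (\<Sum>j\<in>nbr_block E (sel t) i l. (A l t i j / \<Phi> (Suc t) i l) *\<^sub>R
           (\<Phi> t j l *\<^sub>R (Y t j $ l) + gf j (X (Suc t) j) $ l - gf j (X t j) $ l))"
begin

abbreviation K :: "(real^'d^'b) set" where "K \<equiv> prod_set Kb"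

subsection \<open>Mixing weights\<close>

lemma A_nonneg: "0 \<le> A l t i j"
  using A_pos[of j i t l] A_zero[of j i t l] \<kappa>_pos by (cases "(j, i) \<in> edges_block E (sel t) l") auto

lemma A_loop: "\<kappa> < A l t i i"
  by (rule A_pos) (simp add: edges_block_def nbr_block_def E_loops)

lemma \<kappa>_less_1: "\<kappa> < 1"
proof -
  have "A l t i i \<le> (\<Sum>k\<in>UNIV. A l t k i)" for l t i
    by (rule member_le_sum) (auto intro: A_nonneg)
  then show ?thesis using A_loop[of undefined undefined undefined] A_colstoch by (metis less_le_trans)
qed

lemma sum_nbr_block:
  assumes "\<And>j. A l t i j = 0 \<Longrightarrow> h j = 0"
  shows "(\<Sum>j\<in>nbr_block E (sel t) i l. h j) = (\<Sum>j\<in>UNIV. h j)"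
  by (rule sum.mono_neutral_left) (auto intro!: assms A_zero simp: edges_block_def)

lemma common_window: "\<exists>T. \<forall>t i l. \<exists>s<T. sel (t + s) i = l"
proof -
  obtain T where T: "\<And>i t. (\<Union>s<T i. {sel (t + s) i}) = UNIV" using sel_ess_cyclic by metis
  have "\<exists>s<Max (range T). sel (t + s) i = l" for t i l
  proof -
    have "l \<in> (\<Union>s<T i. {sel (t + s) i})" by (simp only: T UNIV_I)
    then obtain s where "s < T i" "sel (t + s) i = l" by auto
    moreover have "T i \<le> Max (range T)" by simp
    ultimately show ?thesis using less_le_trans by blast
  qed
  then show ?thesis by blast
qed

text \<open>Apart from self-loops, an edge carries weight for block \<open>l\<close> only when its
  tail has selected \<open>l\<close>, so the block graph at one time need not be connected. Within a
  window of length \<open>T\<close> every tail selects \<open>l\<close> at some time, and all edges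
  of \<open>E\<close> have appeared.\<close>

lemma A_window: "\<exists>T. \<forall>l t i j. (j, i) \<in> E \<longrightarrow> (\<exists>s<T. \<kappa> \<le> A l (t + s) i j)"
proof -
  obtain T where T: "\<And>t i l. \<exists>s<T. sel (t + s) i = l" using common_window by blast
  have "\<exists>s<T. \<kappa> \<le> A l (t + s) i j" if "(j, i) \<in> E" for l t i j
  proof -
    obtain s where s: "s < T" "sel (t + s) j = l" using T by blast
    then have "(j, i) \<in> edges_block E (sel (t + s)) l" using that by (simp add: edges_block_def nbr_block_def)
    then show ?thesis using A_pos s by (meson less_imp_le)
  qed
  then show ?thesis by blast
qed

lemma \<Phi>_Suc: "\<Phi> (Suc t) i l = (\<Sum>j\<in>UNIV. A l t i j * \<Phi> t j l)"
  unfolding upd_\<Phi> by (rule sum_nbr_block) simp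

lemma \<Phi>_sum: "(\<Sum>i\<in>UNIV. \<Phi> t i l) = real CARD('a)"
proof (induction t)
  case (Suc t)
  have "(\<Sum>i\<in>UNIV. \<Phi> (Suc t) i l) = (\<Sum>j\<in>UNIV. \<Sum>i\<in>UNIV. A l t i j * \<Phi> t j l)"
    unfolding \<Phi>_Suc by (rule sum.swap)
  then show ?case using Suc by (simp add: A_colstoch flip: sum_distrib_right)
qed (simp add: init_\<Phi>)

text \<open>A bound through the self-loops alone. It decays, but it gives positivity and covers the
  first few iterations in the uniform bound \<open>\<Phi>_lower\<close>.\<close>

lemma \<Phi>_ge_power: "\<kappa> ^ t \<le> \<Phi> t i l"
proof (induction t arbitrary: i)
  case (Suc t)
  have nonneg: "0 \<le> \<Phi> t j l" for j using Suc[of j] \<kappa>_pos by (meson order_trans zero_le_power less_imp_le)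
  have "\<kappa> * \<kappa> ^ t \<le> A l t i i * \<Phi> t i l"
    by (rule mult_mono) (use Suc A_loop \<kappa>_pos A_nonneg in \<open>auto simp: less_imp_le\<close>)
  also have "\<dots> \<le> \<Phi> (Suc t) i l"
    unfolding \<Phi>_Suc by (rule member_le_sum[of i UNIV "\<lambda>j. A l t i j * \<Phi> t j l"]) (auto simp: A_nonneg nonneg)
  finally show ?case by simp
qed (simp add: init_\<Phi>)

lemma \<Phi>_pos: "0 < \<Phi> t i l"
  using \<Phi>_ge_power \<kappa>_pos by (meson less_le_trans zero_less_power)

lemma \<Phi>_le: "\<Phi> t i l \<le> real CARD('a)"
  using member_le_sum[of i UNIV "\<lambda>i. \<Phi> t i l"] \<Phi>_sum[of t l] \<Phi>_pos by (simp add: less_imp_le)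

lemma \<Phi>_transition: "\<Phi> (t + p) i l = (\<Sum>j\<in>UNIV. transition (A l) t p i j * \<Phi> t j l)"
proof (induction p arbitrary: i)
  case 0
  then show ?case by (simp add: if_distrib[of "\<lambda>x. x * _"] cong: if_cong)
next
  case (Suc p)
  have "\<Phi> (t + Suc p) i l = (\<Sum>k\<in>UNIV. A l (t + p) i k * (\<Sum>j\<in>UNIV. transition (A l) t p k j * \<Phi> t j l))"
    by (simp add: \<Phi>_Suc Suc)
  also have "\<dots> = (\<Sum>j\<in>UNIV. \<Sum>k\<in>UNIV. A l (t + p) i k * transition (A l) t p k j * \<Phi> t j l)"
    by (subst sum.swap) (simp add: sum_distrib_left mult.assoc)
  finally show ?case by (simp add: sum_distrib_right)
qed

text \<open>After \<open>P l\<close> steps every entry of the product of the matrices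
  \<open>A l\<close> is at least \<open>\<kappa> ^ P l\<close>, so each agent receives that fraction
  of the conserved total mass \<open>CARD('a) \<ge> 1\<close>. Earlier times are covered by
  \<open>\<Phi>_ge_power\<close>.\<close>

lemma \<Phi>_lower: "\<exists>c>0. \<forall>t i l. c \<le> \<Phi> t i l"
proof -
  obtain T where T: "\<And>l t i j. (j, i) \<in> E \<Longrightarrow> \<exists>s<T. \<kappa> \<le> A l (t + s) i j" using A_window by blast
  have "\<exists>P>0. \<forall>t i j. \<kappa> ^ P \<le> transition (A l) t P i j" for l
    by (rule transition_uniformly_positive[where E = E and T = T])
      (use A_nonneg \<kappa>_pos A_loop T E_strong in \<open>auto simp: less_imp_le\<close>)
  then obtain P where P: "\<And>l t i j. \<kappa> ^ P l \<le> transition (A l) t (P l) i j" by metis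
  have "\<kappa> ^ P l \<le> \<Phi> t i l" for t i l
  proof (cases "t < P l")
    case True
    then have "\<kappa> ^ P l \<le> \<kappa> ^ t" using \<kappa>_pos \<kappa>_less_1 by (intro power_decreasing) auto
    then show ?thesis using \<Phi>_ge_power order_trans by blast
  next
    case False
    then obtain s where s: "t = s + P l" by (metis add.commute le_Suc_ex not_less)
    have "\<kappa> ^ P l * 1 \<le> \<kappa> ^ P l * real CARD('a)" using \<kappa>_pos by (intro mult_left_mono) (auto simp: Suc_le_eq)
    also have "\<dots> = (\<Sum>j\<in>UNIV. \<kappa> ^ P l * \<Phi> s j l)" by (simp add: \<Phi>_sum flip: sum_distrib_left)
    also have "\<dots> \<le> \<Phi> t i l"
      unfolding s \<Phi>_transition by (intro sum_mono mult_right_mono P) (simp add: \<Phi>_pos less_imp_le)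
    finally show ?thesis by simp
  qed
  moreover obtain c where "c > 0" "\<And>l. c \<le> \<kappa> ^ P l"
    using uniform_positive_constant[of "\<lambda>l. \<kappa> ^ P l"] \<kappa>_pos by auto
  ultimately show ?thesis by (meson order_trans)
qed

definition W :: "'b \<Rightarrow> nat \<Rightarrow> 'a \<Rightarrow> 'a \<Rightarrow> real" where
  "W l t i j = A l t i j * \<Phi> t j l / \<Phi> (Suc t) i l"

lemma W_nonneg: "0 \<le> W l t i j"
  unfolding W_def by (intro divide_nonneg_pos mult_nonneg_nonneg A_nonneg \<Phi>_pos less_imp_le[OF \<Phi>_pos])

lemma W_sum: "sum (W l t i) UNIV = 1"
  using \<Phi>_pos[of "Suc t" i l] unfolding W_def sum_divide_distrib[symmetric] \<Phi>_Suc[symmetric] by simp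

text \<open>The vectors \<open>\<Phi> t\<close> form a sequence of left eigenvectors:
  \<open>\<Phi> (Suc t)\<close> times \<open>W l t\<close> is \<open>\<Phi> t\<close>, because
  \<open>A\<close> is column stochastic. Mixing thus leaves \<Phi>-weighted sums unchanged, which is
  why averages are taken with these weights.\<close>

lemma W_weighted_sum:
  "(\<Sum>i\<in>UNIV. \<Phi> (Suc t) i l *\<^sub>R (\<Sum>j\<in>UNIV. W l t i j *\<^sub>R v j)) = (\<Sum>j\<in>UNIV. \<Phi> t j l *\<^sub>R (v j :: 'v::real_vector))"
proof -
  have "\<Phi> (Suc t) i l * W l t i j = A l t i j * \<Phi> t j l" for i j
    using \<Phi>_pos[of "Suc t" i l] by (simp add: W_def)
  then have "(\<Sum>i\<in>UNIV. \<Phi> (Suc t) i l *\<^sub>R (\<Sum>j\<in>UNIV. W l t i j *\<^sub>R v j))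
      = (\<Sum>j\<in>UNIV. \<Sum>i\<in>UNIV. (A l t i j * \<Phi> t j l) *\<^sub>R v j)"
    by (subst sum.swap) (simp add: scaleR_sum_right)
  then show ?thesis by (simp add: A_colstoch flip: scaleR_left.sum sum_distrib_right)
qed

lemma W_lower:
  "\<exists>\<eta> T. 0 < \<eta> \<and> \<eta> < 1 \<and> (\<forall>l t i. \<eta> \<le> W l t i i) \<and> (\<forall>l t i j. (j, i) \<in> E \<longrightarrow> (\<exists>s<T. \<eta> \<le> W l (t + s) i j))"
proof -
  obtain T where T: "\<And>l t i j. (j, i) \<in> E \<Longrightarrow> \<exists>s<T. \<kappa> \<le> A l (t + s) i j" using A_window by blast
  obtain c where c: "c > 0" "\<And>t i l. c \<le> \<Phi> t i l" using \<Phi>_lower by blast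
  \<comment> \<open>The numerator of an active weight is at least \<open>\<kappa> * c\<close>, and
    its denominator is at most \<open>CARD('a)\<close> by \<open>\<Phi>_le\<close>.\<close>
  define \<eta> where "\<eta> = \<kappa> * c / real CARD('a)"
  have W: "\<eta> \<le> W l t i j" if "\<kappa> \<le> A l t i j" for l t i j
    unfolding W_def \<eta>_def using that c \<kappa>_pos
    by (intro frac_le mult_mono mult_nonneg_nonneg \<Phi>_pos \<Phi>_le A_nonneg less_imp_le[OF \<Phi>_pos]) auto
  have "\<eta> \<le> \<kappa> * 1"
    using order_trans[OF c(2) \<Phi>_le] \<kappa>_pos unfolding \<eta>_def times_divide_eq_right[symmetric]
    by (intro mult_left_mono) auto
  then have "\<eta> < 1" using \<kappa>_less_1 by simp
  moreover have "0 < \<eta>" using c \<kappa>_pos by (simp add: \<eta>_def)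
  moreover have "\<eta> \<le> W l t i i" for l t i by (rule W) (simp add: A_loop less_imp_le)
  moreover have "\<exists>s<T. \<eta> \<le> W l (t + s) i j" if "(j, i) \<in> E" for l t i j using T[OF that] W by blast
  ultimately show ?thesis by blast
qed

lemma
  fixes u :: "nat \<Rightarrow> 'a \<Rightarrow> 'v::real_normed_vector"
  assumes u: "\<And>t i. u (Suc t) i = (\<Sum>j\<in>UNIV. W l t i j *\<^sub>R (u t j + \<epsilon> t j))"
    and \<epsilon>: "\<And>t j. norm (\<epsilon> t j) \<le> e t"
  shows consensus_bounded: "(\<And>t. e t \<le> c) \<Longrightarrow> \<exists>M. \<forall>t. spread (u t) \<le> M"
    and consensus_square_summable: "summable (\<lambda>t. (e t)\<^sup>2) \<Longrightarrow> summable (\<lambda>t. (spread (u t))\<^sup>2)"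
proof -
  obtain \<eta> T where \<eta>: "0 < \<eta>" "\<eta> < 1" "\<And>t i. \<eta> \<le> W l t i i"
      "\<And>t i j. (j, i) \<in> E \<Longrightarrow> \<exists>s<T. \<eta> \<le> W l (t + s) i j"
    using W_lower by blast
  show "\<exists>M. \<forall>t. spread (u t) \<le> M" if "\<And>t. e t \<le> c"
    by (rule perturbed_consensus_bounded[where W = "W l" and E = E and T = T and \<epsilon> = \<epsilon> and e = e and \<eta> = \<eta>])
      (use W_nonneg W_sum \<eta> E_strong u \<epsilon> that in auto)
  show "summable (\<lambda>t. (spread (u t))\<^sup>2)" if "summable (\<lambda>t. (e t)\<^sup>2)"
    by (rule perturbed_consensus_square_summable[where W = "W l" and E = E and T = T and \<epsilon> = \<epsilon> and e = e and \<eta> = \<eta>])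
      (use W_nonneg W_sum \<eta> E_strong u \<epsilon> that in auto)
qed

lemma weighted_mean_diff_le_spread:
  fixes u :: "'a \<Rightarrow> 'v::real_normed_vector"
  shows "norm (u i - (1 / real CARD('a)) *\<^sub>R (\<Sum>j\<in>UNIV. \<Phi> t j l *\<^sub>R u j)) \<le> spread u"
proof -
  have "norm ((\<Sum>j\<in>UNIV. (\<Phi> t j l / real CARD('a)) *\<^sub>R u j) - u i) \<le> spread u"
    by (rule norm_convex_combination_diff_le)
      (auto simp: \<Phi>_sum \<Phi>_pos less_imp_le norm_diff_le_spread simp flip: sum_divide_distrib)
  then show ?thesis by (simp add: scaleR_sum_right norm_minus_commute)
qed

subsection \<open>The iterates\<close>

definition \<Delta> :: "nat \<Rightarrow> 'a \<Rightarrow> 'b \<Rightarrow> real^'d" where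
  "\<Delta> t j l = (if l = sel t j then Xt t j - X t j $ l else 0)"

lemma X_Suc: "X (Suc t) i $ l = (\<Sum>j\<in>UNIV. W l t i j *\<^sub>R (X t j $ l + \<gamma> t *\<^sub>R \<Delta> t j l))"
  unfolding upd_X \<Delta>_def W_def by (rule sum_nbr_block) simp

text \<open>Dividing the gradient increment by \<open>\<Phi> t j l\<close> lets the same matrix
  \<open>W\<close> act on trackers and iterates; the uniform lower bound on \<open>\<Phi>\<close>
  keeps this perturbation under control.\<close>

lemma Y_Suc: "Y (Suc t) i $ l = (\<Sum>j\<in>UNIV. W l t i j *\<^sub>R
    (Y t j $ l + (1 / \<Phi> t j l) *\<^sub>R (gf j (X (Suc t) j) $ l - gf j (X t j) $ l)))"
proof -
  have "Y (Suc t) i $ l = (\<Sum>j\<in>UNIV. (A l t i j / \<Phi> (Suc t) i l) *\<^sub>R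
           (\<Phi> t j l *\<^sub>R (Y t j $ l) + gf j (X (Suc t) j) $ l - gf j (X t j) $ l))"
    unfolding upd_Y by (rule sum_nbr_block) simp
  also have "\<dots> = (\<Sum>j\<in>UNIV. W l t i j *\<^sub>R
    (Y t j $ l + (1 / \<Phi> t j l) *\<^sub>R (gf j (X (Suc t) j) $ l - gf j (X t j) $ l)))"
  proof (rule sum.cong[OF refl])
    fix j
    show "(A l t i j / \<Phi> (Suc t) i l) *\<^sub>R (\<Phi> t j l *\<^sub>R (Y t j $ l) + gf j (X (Suc t) j) $ l - gf j (X t j) $ l)
      = W l t i j *\<^sub>R (Y t j $ l + (1 / \<Phi> t j l) *\<^sub>R (gf j (X (Suc t) j) $ l - gf j (X t j) $ l))"
      using \<Phi>_pos[of t j l] by (simp add: W_def scaleR_add_right scaleR_diff_right)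
  qed
  finally show ?thesis .
qed

lemma X_in_K: "X t i \<in> K"
proof (induction t arbitrary: i)
  case (Suc t)
  have "X t j $ l + \<gamma> t *\<^sub>R \<Delta> t j l \<in> Kb l" for j l
  proof (cases "l = sel t j")
    case True
    have "X t j $ l + \<gamma> t *\<^sub>R \<Delta> t j l = (1 - \<gamma> t) *\<^sub>R (X t j $ l) + \<gamma> t *\<^sub>R Xt t j"
      using True by (simp add: \<Delta>_def algebra_simps)
    also have "\<dots> \<in> Kb l"
      by (rule convexD[OF K_convex])
        (use Suc[of j] Xt_mem[of t j] True \<gamma>_le1 \<gamma>_pos[of t] in \<open>auto simp: prod_set_def\<close>)
    finally show ?thesis .
  qed (use Suc in \<open>simp add: \<Delta>_def prod_set_def\<close>)
  then show ?case
    unfolding prod_set_def X_Suc mem_Collect_eq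
    by (intro allI convex_sum K_convex W_sum W_nonneg) auto
qed (rule init_X)

lemma X_block_in_K: "X t i $ l \<in> Kb l"
  using X_in_K[of t i] by (simp add: prod_set_def)

text \<open>The tracking invariant: mixing conserves the weighted sum and the gradient increments
  telescope from the initial gradients. The weighted mean of the trackers is therefore the gradient
  sum divided by the number of agents, which explains the factor \<open>CARD('a)\<close> in the
  subproblem.\<close>

lemma Y_weighted_sum: "(\<Sum>i\<in>UNIV. \<Phi> t i l *\<^sub>R (Y t i $ l)) = (\<Sum>i\<in>UNIV. gf i (X t i) $ l)"
proof (induction t)
  case (Suc t)
  have \<Phi>: "\<Phi> t j l \<noteq> 0" for j using \<Phi>_pos[of t j l] by simp
  show ?case
    unfolding Y_Suc W_weighted_sum
    by (simp add: scaleR_add_right sum.distrib Suc \<Phi> sum_subtractf)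
qed (simp add: init_\<Phi> init_Y)

lemma gf_bound: "\<exists>C\<ge>0. \<forall>i. \<forall>x\<in>K. norm (gf i x) \<le> C"
  using gf_bdd by (intro uniform_constant) (auto simp: bounded_iff intro: order_trans)

lemma gf_lipschitz: "\<exists>L\<ge>0. \<forall>i. \<forall>x\<in>K. \<forall>y\<in>K. norm (gf i x - gf i y) \<le> L * norm (x - y)"
proof (rule uniform_constant)
  show "\<exists>L. \<forall>x\<in>K. \<forall>y\<in>K. norm (gf i x - gf i y) \<le> L * norm (x - y)" for i
    using gf_lip[of i] by (auto simp: lipschitz_on_def dist_norm)
qed (meson mult_right_mono norm_ge_zero order_trans)

lemma ft_lipschitz:
  "\<exists>L\<ge>0. \<forall>i l. \<forall>z\<in>Kb l. \<forall>x\<in>K. \<forall>y\<in>K. norm (gft i l z x - gft i l z y) \<le> L * norm (x - y)"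
proof -
  \<comment> \<open>Agent and block are packed into one finite index so that a single application of
    \<open>uniform_constant\<close> covers both.\<close>
  have "\<exists>L\<ge>0. \<forall>p. \<forall>z\<in>Kb (snd p). \<forall>x\<in>K. \<forall>y\<in>K.
      norm (gft (fst p) (snd p) z x - gft (fst p) (snd p) z y) \<le> L * norm (x - y)"
  proof (rule uniform_constant)
    show "\<exists>L. \<forall>z\<in>Kb (snd p). \<forall>x\<in>K. \<forall>y\<in>K.
      norm (gft (fst p) (snd p) z x - gft (fst p) (snd p) z y) \<le> L * norm (x - y)" for p
      using ft_lip[where i = "fst p" and l = "snd p"] unfolding lipschitz_on_def dist_norm by blast
  qed (meson mult_right_mono norm_ge_zero order_trans)
  then show ?thesis by (metis fst_conv snd_conv)
qed

text \<open>One-sided, with the subgradient taken at \<open>z\<close>: only \<open>z\<close> has to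
  lie in the constraint set, where subgradients are bounded.\<close>

lemma r_lipschitz: "\<exists>M\<ge>0. \<forall>l. \<forall>z\<in>Kb l. \<forall>y. r l z - r l y \<le> M * norm (y - z)"
proof (rule uniform_constant)
  show "\<exists>M. \<forall>z\<in>Kb l. \<forall>y. r l z - r l y \<le> M * norm (y - z)" for l
  proof -
    obtain M where M: "\<And>z g. z \<in> Kb l \<Longrightarrow> is_subgradient (r l) z g \<Longrightarrow> norm g \<le> M"
      using r_subgrad_bdd by blast
    have "r l z - r l y \<le> M * norm (y - z)" if z: "z \<in> Kb l" for z y
    proof -
      obtain g where g: "is_subgradient (r l) z g" using subgradient_exists[OF r_convex] by blast
      then have "r l z + inner g (y - z) \<le> r l y" by (simp add: is_subgradient_def)
      moreover have "- inner g (y - z) \<le> norm g * norm (y - z)"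
        using Cauchy_Schwarz_ineq2[of g "y - z"] by linarith
      moreover have "norm g * norm (y - z) \<le> M * norm (y - z)"
        by (intro mult_right_mono M[OF z g]) simp
      ultimately show ?thesis by linarith
    qed
    then show ?thesis by blast
  qed
qed (meson mult_right_mono norm_ge_zero order_trans)

text \<open>The gradient increments are bounded by twice the gradient bound instead of through
  Lipschitz continuity, since nothing is known yet about the steps of \<open>X\<close>. Bounded
  perturbations give bounded spread, and the invariant bounds the mean.\<close>

lemma Y_bounded: "\<exists>C\<ge>0. \<forall>l t i. norm (Y t i $ l) \<le> C"
proof (rule uniform_constant)
  fix l
  obtain B where B: "B \<ge> 0" "\<And>i x. x \<in> K \<Longrightarrow> norm (gf i x) \<le> B" using gf_bound by blast
  have B': "norm (gf i x $ l) \<le> B" if "x \<in> K" for i x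
    by (rule order_trans[OF Finite_Cartesian_Product.norm_nth_le B(2)[OF that]])
  obtain c where c: "c > 0" "\<And>t i l. c \<le> \<Phi> t i l" using \<Phi>_lower by blast
  have "\<exists>M. \<forall>t. spread (\<lambda>i. Y t i $ l) \<le> M"
  proof (rule consensus_bounded[OF Y_Suc, where e = "\<lambda>t. (B + B) / c"])
    fix t j
    have "norm (gf j (X (Suc t) j) $ l - gf j (X t j) $ l) \<le> B + B"
      by (intro norm_triangle_le_diff add_mono B' X_in_K)
    then have "norm (gf j (X (Suc t) j) $ l - gf j (X t j) $ l) / \<Phi> t j l \<le> (B + B) / c"
      using c B by (intro frac_le) auto
    then show "norm ((1 / \<Phi> t j l) *\<^sub>R (gf j (X (Suc t) j) $ l - gf j (X t j) $ l)) \<le> (B + B) / c"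
      using \<Phi>_pos[of t j l] by simp
  qed (rule order_refl)
  then obtain M where M: "\<And>t. spread (\<lambda>i. Y t i $ l) \<le> M" by blast
  have "norm (Y t i $ l) \<le> M + B" for t i
  proof -
    let ?m = "(1 / real CARD('a)) *\<^sub>R (\<Sum>j\<in>UNIV. \<Phi> t j l *\<^sub>R (Y t j $ l))"
    have "norm (Y t i $ l - ?m) \<le> M"
      using weighted_mean_diff_le_spread[of "\<lambda>i. Y t i $ l" i t l] M[of t] by simp
    moreover have "norm ?m \<le> B"
    proof -
      have "norm (\<Sum>j\<in>UNIV. gf j (X t j) $ l) \<le> real CARD('a) * B"
        using B' X_in_K by (intro sum_norm_bound) auto
      then show ?thesis unfolding Y_weighted_sum by (simp add: pos_divide_le_eq mult.commute)
    qed
    ultimately show ?thesis using norm_triangle_sub[of "Y t i $ l" ?m] by linarith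
  qed
  then show "\<exists>C. \<forall>t i. norm (Y t i $ l) \<le> C" by blast
qed (blast intro: order_trans)

subsection \<open>Best responses\<close>

text \<open>The first-order optimality condition of the block subproblem at \<open>w\<close> whose linear term is \<open>q\<close>.\<close>

definition best_response :: "'a \<Rightarrow> 'b \<Rightarrow> real^'d^'b \<Rightarrow> real^'d \<Rightarrow> real^'d \<Rightarrow> bool" where
  "best_response i l w q z \<longleftrightarrow>
     z \<in> Kb l \<and> (\<forall>y\<in>Kb l. 0 \<le> inner (gft i l z w + q) (y - z) + r l y - r l z)"

lemma best_response_of_minimizer:
  assumes w: "w \<in> K" and z: "z \<in> Kb l"
    and min: "\<And>y. y \<in> Kb l \<Longrightarrow>
      ft i l z w + inner q (z - v) + r l z \<le> ft i l y w + inner q (y - v) + r l y"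
  shows "best_response i l w q z"
proof -
  have d: "GDERIV (\<lambda>z. ft i l z w + inner q (z - v)) z :> gft i l z w + q"
    using ft_deriv[OF w z] unfolding gderiv_def
    by (auto intro!: derivative_eq_intros simp: inner_add_right inner_commute)
  have r: "convex_on (Kb l) (r l)" using r_convex convex_on_subset K_convex by blast
  have "0 \<le> inner (gft i l z w + q) (y - z) + r l y - r l z" if y: "y \<in> Kb l" for y
    by (rule minimizer_variational_inequality[OF K_convex r z y _ d]) (use min in auto)
  then show ?thesis using z by (simp add: best_response_def)
qed

lemma best_response_exists:
  assumes w: "w \<in> K"
  shows "\<exists>z. best_response i l w q z"
proof -
  have "convex_on UNIV (\<lambda>z. inner q z)"
    by (auto simp: convex_on_def inner_add_right)
  then have conv: "convex_on UNIV (\<lambda>z. inner q z + r l z)"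
    by (rule convex_on_add[OF _ r_convex])
  have "\<exists>x\<in>Kb l. \<forall>z\<in>Kb l. ft i l x w + (inner q x + r l x) \<le> ft i l z w + (inner q z + r l z)"
    by (rule strongly_convex_minimizer_exists[OF K_closed K_ne \<tau>_pos ft_strong[OF w] ft_deriv[OF w] conv])
  then obtain x where "x \<in> Kb l"
      "\<And>z. z \<in> Kb l \<Longrightarrow> ft i l x w + (inner q x + r l x) \<le> ft i l z w + (inner q z + r l z)" by blast
  then have "best_response i l w q x"
    using w by (intro best_response_of_minimizer[where v = 0]) (auto simp: add.assoc)
  then show ?thesis by blast
qed

lemma best_response_Xt:
  "best_response i (sel t i) (X t i) (real CARD('a) *\<^sub>R (Y t i $ sel t i) - gf i (X t i) $ sel t i) (Xt t i)"
  by (rule best_response_of_minimizer[OF X_in_K Xt_mem Xt_min])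

text \<open>Each optimality condition is tested at the other solution and the two are added: the
  values of \<open>r\<close> cancel, and strong monotonicity at the fixed base point
  \<open>w\<close> bounds the distance. It covers uniqueness (equal data) and stability
  alike.\<close>

lemma best_response_perturbation:
  assumes L: "\<And>z x y. z \<in> Kb l \<Longrightarrow> x \<in> K \<Longrightarrow> y \<in> K \<Longrightarrow> norm (gft i l z x - gft i l z y) \<le> L * norm (x - y)"
    and w: "w \<in> K" "w' \<in> K"
    and z: "best_response i l w q z" "best_response i l w' q' z'"
  shows "\<tau> i * norm (z - z') \<le> L * norm (w - w') + norm (q - q')"
proof (cases "z = z'")
  case True
  have "0 \<le> L * norm (w - w')"
    using order_trans[OF norm_ge_zero L[of z w w']] w z by (auto simp: best_response_def)
  then show ?thesis using True by simp
next
  case False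
  have zK: "z \<in> Kb l" "z' \<in> Kb l" using z by (auto simp: best_response_def)
  let ?d = "(gft i l z' w - gft i l z' w') + (q - q')"
  have "0 \<le> inner (gft i l z w + q) (z' - z) + r l z' - r l z"
    "0 \<le> inner (gft i l z' w' + q') (z - z') + r l z - r l z'"
    using z zK by (auto simp: best_response_def)
  moreover have "\<tau> i * (norm (z - z'))\<^sup>2 \<le> inner (gft i l z w - gft i l z' w) (z - z')"
    by (rule strongly_convex_on_gradient_monotone[OF ft_strong[OF w(1)] zK ft_deriv ft_deriv])
      (use w zK in auto)
  ultimately have "\<tau> i * (norm (z - z'))\<^sup>2 \<le> inner ?d (z' - z)"
    by (simp add: inner_diff_left inner_diff_right inner_add_left)
  also have "\<dots> \<le> norm ?d * norm (z' - z)" by (rule norm_cauchy_schwarz)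
  also have "\<dots> \<le> (L * norm (w - w') + norm (q - q')) * norm (z' - z)"
    using L[OF zK(2) w] by (intro mult_right_mono norm_triangle_mono) auto
  finally have "(\<tau> i * norm (z - z')) * norm (z - z') \<le> (L * norm (w - w') + norm (q - q')) * norm (z - z')"
    by (simp add: power2_eq_square mult.assoc norm_minus_commute)
  then show ?thesis using False by simp
qed

text \<open>Optimality of \<open>Xt\<close> is tested at the current block. Strong monotonicity
  trades the surrogate gradient at \<open>Xt\<close> for that at the iterate, and gradient
  consistency makes the latter cancel the local gradient in the linear term. For an unselected block
  both sides vanish.\<close>

lemma \<Delta>_descent:
  "inner (real CARD('a) *\<^sub>R (Y t i $ l)) (\<Delta> t i l) + r l (X t i $ l + \<Delta> t i l) - r l (X t i $ l)
    \<le> - \<tau> i * (norm (\<Delta> t i l))\<^sup>2"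
proof (cases "l = sel t i")
  case True
  let ?x = "X t i $ l" and ?z = "Xt t i"
  have z: "?z \<in> Kb l" using Xt_mem True by simp
  have "0 \<le> inner (gft i l ?z (X t i) + (real CARD('a) *\<^sub>R (Y t i $ l) - gf i (X t i) $ l)) (?x - ?z) + r l ?x - r l ?z"
    using best_response_Xt[of i t] X_block_in_K[of t i l] True by (simp add: best_response_def)
  moreover have "\<tau> i * (norm (?z - ?x))\<^sup>2 \<le> inner (gft i l ?z (X t i) - gf i (X t i) $ l) (?z - ?x)"
    using strongly_convex_on_gradient_monotone[OF ft_strong[OF X_in_K] z X_block_in_K
        ft_deriv[OF X_in_K z] ft_deriv[OF X_in_K X_block_in_K], of i t i t i]
    by (simp add: ft_grad_cons X_in_K)
  ultimately show ?thesis
    using True by (simp add: \<Delta>_def inner_diff_left inner_diff_right inner_add_left)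
qed (simp add: \<Delta>_def)

text \<open>In \<open>\<Delta>_descent\<close> the decrease is quadratic in the length of the
  direction, while tracker and regularizer contribute only linearly; one factor of the length is
  divided out.\<close>

lemma \<Delta>_bounded: "\<exists>C\<ge>0. \<forall>t i l. norm (\<Delta> t i l) \<le> C"
proof -
  obtain B where B: "B \<ge> 0" "\<And>t i l. norm (Y t i $ l) \<le> B" using Y_bounded by blast
  obtain M where M: "M \<ge> 0" "\<And>l z y. z \<in> Kb l \<Longrightarrow> r l z - r l y \<le> M * norm (y - z)"
    using r_lipschitz by blast
  obtain c where c: "c > 0" "\<And>i. c \<le> \<tau> i" using uniform_positive_constant[of \<tau>] \<tau>_pos by blast
  have "norm (\<Delta> t i l) \<le> (real CARD('a) * B + M) / c" for t i l
  proof (cases "\<Delta> t i l = 0")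
    case True then show ?thesis using B M c by simp
  next
    case False
    let ?n = "norm (\<Delta> t i l)"
    have "\<tau> i * ?n\<^sup>2 \<le> - inner (real CARD('a) *\<^sub>R (Y t i $ l)) (\<Delta> t i l) + (r l (X t i $ l) - r l (X t i $ l + \<Delta> t i l))"
      using \<Delta>_descent[of t i l] by simp
    also have "\<dots> \<le> real CARD('a) * B * ?n + M * ?n"
    proof (rule add_mono)
      have "- inner (real CARD('a) *\<^sub>R (Y t i $ l)) (\<Delta> t i l) \<le> norm (real CARD('a) *\<^sub>R (Y t i $ l)) * ?n"
        using Cauchy_Schwarz_ineq2[of "real CARD('a) *\<^sub>R (Y t i $ l)" "\<Delta> t i l"] by linarith
      also have "\<dots> \<le> real CARD('a) * B * ?n" using B by (intro mult_right_mono) (auto intro: mult_left_mono)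
      finally show "- inner (real CARD('a) *\<^sub>R (Y t i $ l)) (\<Delta> t i l) \<le> real CARD('a) * B * ?n" .
      show "r l (X t i $ l) - r l (X t i $ l + \<Delta> t i l) \<le> M * ?n"
        using M(2)[OF X_block_in_K, of l t i "X t i $ l + \<Delta> t i l"] by simp
    qed
    also have "\<tau> i * ?n\<^sup>2 \<ge> c * ?n\<^sup>2" using c by (intro mult_right_mono) auto
    ultimately have "(c * ?n) * ?n \<le> (real CARD('a) * B + M) * ?n"
      by (simp add: power2_eq_square algebra_simps)
    then have "c * ?n \<le> real CARD('a) * B + M" using False by simp
    then show ?thesis using c by (simp add: pos_le_divide_eq mult.commute)
  qed
  moreover have "0 \<le> (real CARD('a) * B + M) / c" using B M c by simp
  ultimately show ?thesis by blast
qed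

subsection \<open>Consensus and gradient tracking\<close>

definition disagreement :: "nat \<Rightarrow> real" where
  "disagreement t = (\<Sum>l\<in>UNIV. spread (\<lambda>i. X t i $ l))"

definition sbar :: "nat \<Rightarrow> real^'d^'b" where
  "sbar t = (1 / real CARD('a)) *\<^sub>R (\<chi> l. \<Sum>i\<in>UNIV. \<Phi> t i l *\<^sub>R (X t i $ l))"

lemma sbar_nth: "sbar t $ l = (1 / real CARD('a)) *\<^sub>R (\<Sum>i\<in>UNIV. \<Phi> t i l *\<^sub>R (X t i $ l))"
  by (simp add: sbar_def)

lemma disagreement_square_summable: "summable (\<lambda>t. (disagreement t)\<^sup>2)"
  unfolding disagreement_def
proof (rule square_summable_sum)
  fix l
  obtain C where C: "\<And>t i l. norm (\<Delta> t i l) \<le> C" using \<Delta>_bounded by blast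
  show "summable (\<lambda>t. (spread (\<lambda>i. X t i $ l))\<^sup>2)"
  proof (rule consensus_square_summable[OF X_Suc])
    show "norm (\<gamma> t *\<^sub>R \<Delta> t j l) \<le> C * \<gamma> t" for t j
      using C[of t j l] \<gamma>_pos[of t] by (simp add: mult.commute)
    show "summable (\<lambda>t. (C * \<gamma> t)\<^sup>2)"
      by (rule square_summable_cmult[OF \<gamma>_sq_summable])
  qed
qed

lemma X_sbar: "norm (X t i - sbar t) \<le> disagreement t"
proof -
  have "norm (X t i - sbar t) \<le> (\<Sum>l\<in>UNIV. norm ((X t i - sbar t) $ l))" by (rule norm_vec_le_sum)
  also have "\<dots> \<le> disagreement t"
    unfolding disagreement_def using weighted_mean_diff_le_spread[of "\<lambda>i. X t i $ _" i t]
    by (intro sum_mono) (simp add: sbar_nth)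
  finally show ?thesis .
qed

text \<open>Mixing moves an agent even when all directions vanish, hence the disagreement term. Both
  terms are square summable, which is what the tracking error needs.\<close>

lemma X_step: "\<exists>C\<ge>0. \<forall>t i. norm (X (Suc t) i - X t i) \<le> disagreement t + C * \<gamma> t"
proof -
  obtain C where C: "C \<ge> 0" "\<And>t i l. norm (\<Delta> t i l) \<le> C" using \<Delta>_bounded by blast
  have "norm (X (Suc t) i - X t i) \<le> disagreement t + (real CARD('b) * C) * \<gamma> t" for t i
  proof -
    have "norm (X (Suc t) i - X t i) \<le> (\<Sum>l\<in>UNIV. norm ((X (Suc t) i - X t i) $ l))" by (rule norm_vec_le_sum)
    also have "\<dots> \<le> (\<Sum>l\<in>UNIV. spread (\<lambda>i. X t i $ l) + C * \<gamma> t)"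
    proof (rule sum_mono)
      fix l
      have "norm (X (Suc t) i $ l - X t i $ l) \<le> spread (\<lambda>i. X t i $ l) + C * \<gamma> t"
        unfolding X_Suc
      proof (rule norm_convex_combination_diff_le[OF W_nonneg W_sum])
        fix j
        have "norm (X t j $ l - X t i $ l + \<gamma> t *\<^sub>R \<Delta> t j l) \<le> spread (\<lambda>i. X t i $ l) + C * \<gamma> t"
          using norm_diff_le_spread[of "\<lambda>i. X t i $ l" j i] C(2)[of t j l] \<gamma>_pos[of t]
          by (intro norm_triangle_mono) (auto simp: mult.commute)
        then show "norm (X t j $ l + \<gamma> t *\<^sub>R \<Delta> t j l - X t i $ l) \<le> spread (\<lambda>i. X t i $ l) + C * \<gamma> t"
          by (simp add: algebra_simps)
      qed
      then show "norm ((X (Suc t) i - X t i) $ l) \<le> spread (\<lambda>i. X t i $ l) + C * \<gamma> t" by simp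
    qed
    also have "\<dots> = disagreement t + (real CARD('b) * C) * \<gamma> t"
      by (simp add: disagreement_def sum.distrib)
    finally show ?thesis .
  qed
  moreover have "0 \<le> real CARD('b) * C" using C by simp
  ultimately show ?thesis by blast
qed

lemma Y_spread_square_summable: "summable (\<lambda>t. (spread (\<lambda>i. Y t i $ l))\<^sup>2)"
proof -
  obtain C where C: "C \<ge> 0" "\<And>t i. norm (X (Suc t) i - X t i) \<le> disagreement t + C * \<gamma> t" using X_step by blast
  obtain L where L: "L \<ge> 0" "\<And>i x y. x \<in> K \<Longrightarrow> y \<in> K \<Longrightarrow> norm (gf i x - gf i y) \<le> L * norm (x - y)"
    using gf_lipschitz by blast
  obtain c where c: "c > 0" "\<And>t i l. c \<le> \<Phi> t i l" using \<Phi>_lower by blast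
  show ?thesis
  proof (rule consensus_square_summable[OF Y_Suc])
    show "summable (\<lambda>t. (L / c * (disagreement t + C * \<gamma> t))\<^sup>2)"
      by (intro square_summable_cmult square_summable_add disagreement_square_summable \<gamma>_sq_summable)
    fix t j
    let ?g = "gf j (X (Suc t) j) $ l - gf j (X t j) $ l"
    have "norm ?g \<le> norm (gf j (X (Suc t) j) - gf j (X t j))"
      unfolding vector_minus_component[symmetric] by (rule Finite_Cartesian_Product.norm_nth_le)
    also have "\<dots> \<le> L * norm (X (Suc t) j - X t j)" by (intro L X_in_K)
    also have "\<dots> \<le> L * (disagreement t + C * \<gamma> t)" by (intro mult_left_mono C L)
    finally have "norm ?g / \<Phi> t j l \<le> L * (disagreement t + C * \<gamma> t) / c"
      using c by (intro frac_le) (auto intro: order_trans[OF norm_ge_zero])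
    then show "norm ((1 / \<Phi> t j l) *\<^sub>R ?g) \<le> L / c * (disagreement t + C * \<gamma> t)"
      using \<Phi>_pos[of t j l] by simp
  qed
qed

lemma sbar_in_K: "sbar t \<in> K"
proof -
  have "sbar t $ l \<in> Kb l" for l
  proof -
    have "sbar t $ l = (\<Sum>i\<in>UNIV. (\<Phi> t i l / real CARD('a)) *\<^sub>R (X t i $ l))"
      by (simp add: sbar_nth scaleR_sum_right)
    also have "\<dots> \<in> Kb l"
      by (rule convex_sum[OF _ K_convex])
        (auto simp: \<Phi>_sum \<Phi>_pos less_imp_le X_block_in_K simp flip: sum_divide_distrib)
    finally show ?thesis .
  qed
  then show ?thesis by (simp add: prod_set_def)
qed

text \<open>Mixing drops out by \<open>W_weighted_sum\<close>, so the average, unlike the single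
  iterates, moves by a multiple of \<open>\<gamma> t\<close> only.\<close>

lemma sbar_Suc:
  "sbar (Suc t) $ l = sbar t $ l + (\<gamma> t / real CARD('a)) *\<^sub>R (\<Sum>j\<in>UNIV. \<Phi> t j l *\<^sub>R \<Delta> t j l)"
  unfolding sbar_nth X_Suc W_weighted_sum
  by (simp add: scaleR_add_right sum.distrib scaleR_sum_right mult.commute)

lemma sbar_step: "\<exists>C\<ge>0. \<forall>t. norm (sbar (Suc t) - sbar t) \<le> C * \<gamma> t"
proof -
  obtain C where C: "C \<ge> 0" "\<And>t i l. norm (\<Delta> t i l) \<le> C" using \<Delta>_bounded by blast
  have "norm (sbar (Suc t) - sbar t) \<le> (real CARD('b) * C) * \<gamma> t" for t
  proof -
    have "norm ((sbar (Suc t) - sbar t) $ l) \<le> \<gamma> t * C" for l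
    proof -
      have "norm (\<Sum>j\<in>UNIV. \<Phi> t j l *\<^sub>R \<Delta> t j l) \<le> (\<Sum>j\<in>UNIV. \<Phi> t j l * C)"
        using C \<Phi>_pos[of t _ l] by (intro sum_norm_le) (auto simp: less_imp_le intro: mult_left_mono)
      also have "\<dots> = real CARD('a) * C" by (simp add: \<Phi>_sum flip: sum_distrib_right)
      finally have "\<gamma> t / real CARD('a) * norm (\<Sum>j\<in>UNIV. \<Phi> t j l *\<^sub>R \<Delta> t j l)
          \<le> \<gamma> t / real CARD('a) * (real CARD('a) * C)"
        using \<gamma>_pos[of t] by (intro mult_left_mono) auto
      then show ?thesis using \<gamma>_pos[of t] by (simp add: sbar_Suc)
    qed
    then have "(\<Sum>l\<in>UNIV. norm ((sbar (Suc t) - sbar t) $ l)) \<le> real CARD('b) * (\<gamma> t * C)"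
      by (intro sum_bounded_above) auto
    then show ?thesis using norm_vec_le_sum[of "sbar (Suc t) - sbar t"] by (simp add: algebra_simps)
  qed
  moreover have "0 \<le> real CARD('b) * C" using C by simp
  ultimately show ?thesis by blast
qed

definition gF :: "real^'d^'b \<Rightarrow> real^'d^'b" where
  "gF x = (\<Sum>i\<in>UNIV. gf i x)"

lemma gF_lipschitz:
  assumes "\<And>i x y. x \<in> K \<Longrightarrow> y \<in> K \<Longrightarrow> norm (gf i x - gf i y) \<le> L * norm (x - y)" "x \<in> K" "y \<in> K"
  shows "norm (gF x - gF y) \<le> real CARD('a) * L * norm (x - y)"
proof -
  have "norm (\<Sum>i\<in>UNIV. gf i x - gf i y) \<le> real CARD('a) * (L * norm (x - y))"
    using assms by (intro sum_norm_bound) auto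
  then show ?thesis by (simp add: gF_def sum_subtractf mult.assoc)
qed

text \<open>The error splits into the deviation of a tracker from the weighted mean, bounded by the
  spread, and the change from gradients at the agents' own points to gradients at
  \<open>sbar t\<close>, bounded by the disagreement.\<close>

lemma tracking:
  "\<exists>e. summable (\<lambda>t. (e t)\<^sup>2) \<and> (\<forall>t j l. norm (real CARD('a) *\<^sub>R (Y t j $ l) - gF (sbar t) $ l) \<le> e t)"
proof -
  obtain L where L: "L \<ge> 0" "\<And>i x y. x \<in> K \<Longrightarrow> y \<in> K \<Longrightarrow> norm (gf i x - gf i y) \<le> L * norm (x - y)"
    using gf_lipschitz by blast
  define e where "e t = real CARD('a) * (\<Sum>l\<in>UNIV. spread (\<lambda>i. Y t i $ l))
      + real CARD('a) * L * disagreement t" for t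
  have "summable (\<lambda>t. (e t)\<^sup>2)"
    unfolding e_def by (intro square_summable_add square_summable_cmult square_summable_sum
        Y_spread_square_summable disagreement_square_summable)
  moreover have "norm (real CARD('a) *\<^sub>R (Y t j $ l) - gF (sbar t) $ l) \<le> e t" for t j l
  proof -
    let ?m = "(1 / real CARD('a)) *\<^sub>R (\<Sum>j\<in>UNIV. \<Phi> t j l *\<^sub>R (Y t j $ l))"
    have "norm (Y t j $ l - ?m) \<le> spread (\<lambda>i. Y t i $ l)"
      by (rule weighted_mean_diff_le_spread[of "\<lambda>i. Y t i $ l"])
    also have "\<dots> \<le> (\<Sum>l\<in>UNIV. spread (\<lambda>i. Y t i $ l))"
      by (rule member_le_sum[of l UNIV "\<lambda>l. spread (\<lambda>i. Y t i $ l)"]) auto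
    finally have 1: "norm (real CARD('a) *\<^sub>R (Y t j $ l - ?m)) \<le> real CARD('a) * (\<Sum>l\<in>UNIV. spread (\<lambda>i. Y t i $ l))"
      by simp
    have "norm (gf i (X t i) $ l - gf i (sbar t) $ l) \<le> L * disagreement t" for i
    proof -
      have "norm (gf i (X t i) $ l - gf i (sbar t) $ l) \<le> norm (gf i (X t i) - gf i (sbar t))"
        unfolding vector_minus_component[symmetric] by (rule Finite_Cartesian_Product.norm_nth_le)
      also have "\<dots> \<le> L * norm (X t i - sbar t)" by (intro L X_in_K sbar_in_K)
      also have "\<dots> \<le> L * disagreement t" by (intro mult_left_mono X_sbar L)
      finally show ?thesis .
    qed
    then have 2: "norm (\<Sum>i\<in>UNIV. gf i (X t i) $ l - gf i (sbar t) $ l) \<le> real CARD('a) * (L * disagreement t)"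
      by (intro sum_norm_bound) auto
    have "real CARD('a) *\<^sub>R (Y t j $ l) - gF (sbar t) $ l
        = real CARD('a) *\<^sub>R (Y t j $ l - ?m) + (\<Sum>i\<in>UNIV. gf i (X t i) $ l - gf i (sbar t) $ l)"
      unfolding Y_weighted_sum by (simp add: gF_def scaleR_diff_right sum_subtractf)
    then show ?thesis using norm_triangle_mono[OF 1 2] by (simp add: e_def mult.assoc)
  qed
  ultimately show ?thesis by blast
qed

subsection \<open>Descent\<close>

definition U :: "real^'d^'b \<Rightarrow> real" where
  "U x = (\<Sum>i\<in>UNIV. f i x) + (\<Sum>l\<in>UNIV. r l (x $ l))"

text \<open>The regularizer is averaged over the agents instead of being evaluated at \<open>sbar t\<close>: the
  difference of the two is not summable, but the averaged version is monotone under mixing.\<close>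

definition lyapunov :: "nat \<Rightarrow> real" where
  "lyapunov t = (\<Sum>i\<in>UNIV. f i (sbar t)) + (\<Sum>l\<in>UNIV. \<Sum>j\<in>UNIV. \<Phi> t j l / real CARD('a) * r l (X t j $ l))"

text \<open>Jensen's inequality. Through it the coercivity and the lower bound of \<open>U\<close>
  serve for \<open>lyapunov\<close>.\<close>

lemma U_le_lyapunov: "U (sbar t) \<le> lyapunov t"
proof -
  have "r l (sbar t $ l) \<le> (\<Sum>j\<in>UNIV. \<Phi> t j l / real CARD('a) * r l (X t j $ l))" for l
  proof -
    have "sbar t $ l = (\<Sum>i\<in>UNIV. (\<Phi> t i l / real CARD('a)) *\<^sub>R (X t i $ l))"
      by (simp add: sbar_nth scaleR_sum_right)
    also have "r l \<dots> \<le> (\<Sum>j\<in>UNIV. \<Phi> t j l / real CARD('a) * r l (X t j $ l))"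
      by (rule convex_on_sum[OF _ _ r_convex])
        (auto simp: \<Phi>_sum \<Phi>_pos less_imp_le simp flip: sum_divide_distrib)
    finally show ?thesis .
  qed
  then show ?thesis unfolding U_def lyapunov_def by (intro add_left_mono sum_mono)
qed

lemma closed_K: "closed K"
proof -
  have "K = (\<Inter>l. (\<lambda>x. x $ l) -` Kb l)" by (auto simp: prod_set_def)
  then show ?thesis by (auto intro!: closed_INT closed_vimage K_closed continuous_intros)
qed

lemma U_bounded_below: "\<exists>m. \<forall>x\<in>K. m \<le> U x"
proof -
  have coercive: "coercive_on K U" using U_coercive by (simp add: U_def[abs_def])
  then obtain R where R: "\<And>x. x \<in> K \<Longrightarrow> R \<le> norm x \<Longrightarrow> 0 \<le> U x" by (meson coercive_on_def)
  have comp: "compact (K \<inter> cball 0 R)" by (simp add: closed_K closed_Int_compact)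
  have "continuous_on K (f i)" for i
    using f_deriv by (intro continuous_at_imp_continuous_on) (auto simp: gderiv_def dest: has_derivative_continuous)
  moreover have "continuous_on K (\<lambda>x. r l (x $ l))" for l
    by (rule continuous_on_compose2[OF convex_on_continuous[OF open_UNIV r_convex]]) (auto intro!: continuous_intros)
  ultimately have "continuous_on K U" unfolding U_def[abs_def] by (intro continuous_intros)
  then have "bounded (U ` (K \<inter> cball 0 R))"
    using comp by (intro compact_imp_bounded compact_continuous_image) (auto intro: continuous_on_subset)
  then obtain B where B: "\<forall>y\<in>U ` (K \<inter> cball 0 R). norm y \<le> B" unfolding bounded_iff by blast
  have "- \<bar>B\<bar> \<le> U x" if "x \<in> K" for x
  proof (cases "R \<le> norm x")
    case True then show ?thesis using R[OF that] by simp
  next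
    case False
    then have "\<bar>U x\<bar> \<le> B" using B that by auto
    then show ?thesis by linarith
  qed
  then show ?thesis by blast
qed

text \<open>Convexity is used twice: Jensen's inequality passes \<open>r\<close> through the mixing,
  after which \<open>W_weighted_sum\<close> restores the weights \<open>\<Phi> t\<close>; then the
  step of length \<open>\<gamma> t \<le> 1\<close> is bounded by the chord towards the full
  step.\<close>

lemma regularizer_descent:
  "(\<Sum>j\<in>UNIV. \<Phi> (Suc t) j l / real CARD('a) * r l (X (Suc t) j $ l))
    \<le> (\<Sum>j\<in>UNIV. \<Phi> t j l / real CARD('a) * r l (X t j $ l))
      + \<gamma> t / real CARD('a) * (\<Sum>j\<in>UNIV. \<Phi> t j l * (r l (X t j $ l + \<Delta> t j l) - r l (X t j $ l)))"
proof -
  have "(\<Sum>i\<in>UNIV. \<Phi> (Suc t) i l * r l (X (Suc t) i $ l))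
      \<le> (\<Sum>i\<in>UNIV. \<Phi> (Suc t) i l *\<^sub>R (\<Sum>j\<in>UNIV. W l t i j *\<^sub>R r l (X t j $ l + \<gamma> t *\<^sub>R \<Delta> t j l)))"
  proof (rule sum_mono)
    fix i
    have "r l (X (Suc t) i $ l) \<le> (\<Sum>j\<in>UNIV. W l t i j * r l (X t j $ l + \<gamma> t *\<^sub>R \<Delta> t j l))"
      unfolding X_Suc by (rule convex_on_sum[OF _ _ r_convex W_sum W_nonneg]) auto
    then show "\<Phi> (Suc t) i l * r l (X (Suc t) i $ l)
        \<le> \<Phi> (Suc t) i l *\<^sub>R (\<Sum>j\<in>UNIV. W l t i j *\<^sub>R r l (X t j $ l + \<gamma> t *\<^sub>R \<Delta> t j l))"
      using \<Phi>_pos[of "Suc t" i l] by simp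
  qed
  also have "\<dots> = (\<Sum>j\<in>UNIV. \<Phi> t j l * r l (X t j $ l + \<gamma> t *\<^sub>R \<Delta> t j l))"
    unfolding W_weighted_sum by simp
  also have "\<dots> \<le> (\<Sum>j\<in>UNIV. \<Phi> t j l * (r l (X t j $ l) + \<gamma> t * (r l (X t j $ l + \<Delta> t j l) - r l (X t j $ l))))"
  proof (rule sum_mono)
    fix j
    have "X t j $ l + \<gamma> t *\<^sub>R \<Delta> t j l = (1 - \<gamma> t) *\<^sub>R (X t j $ l) + \<gamma> t *\<^sub>R (X t j $ l + \<Delta> t j l)"
      by (simp add: algebra_simps)
    also have "r l \<dots> \<le> (1 - \<gamma> t) * r l (X t j $ l) + \<gamma> t * r l (X t j $ l + \<Delta> t j l)"
      by (rule convex_onD[OF r_convex]) (use \<gamma>_pos[of t] \<gamma>_le1[of t] in auto)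
    finally have "r l (X t j $ l + \<gamma> t *\<^sub>R \<Delta> t j l)
        \<le> r l (X t j $ l) + \<gamma> t * (r l (X t j $ l + \<Delta> t j l) - r l (X t j $ l))"
      by (simp add: algebra_simps)
    then show "\<Phi> t j l * r l (X t j $ l + \<gamma> t *\<^sub>R \<Delta> t j l)
        \<le> \<Phi> t j l * (r l (X t j $ l) + \<gamma> t * (r l (X t j $ l + \<Delta> t j l) - r l (X t j $ l)))"
      using \<Phi>_pos[of t j l] by simp
  qed
  also have "\<dots> = (\<Sum>j\<in>UNIV. \<Phi> t j l * r l (X t j $ l))
      + \<gamma> t * (\<Sum>j\<in>UNIV. \<Phi> t j l * (r l (X t j $ l + \<Delta> t j l) - r l (X t j $ l)))"
    by (simp add: distrib_left sum.distrib sum_distrib_left mult.left_commute)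
  finally have "(\<Sum>i\<in>UNIV. \<Phi> (Suc t) i l * r l (X (Suc t) i $ l)) / real CARD('a) \<le> \<dots> / real CARD('a)"
    by (rule divide_right_mono) simp
  then show ?thesis by (simp add: sum_divide_distrib add_divide_distrib)
qed

lemma smooth_descent:
  assumes L: "\<And>i x y. x \<in> K \<Longrightarrow> y \<in> K \<Longrightarrow> norm (gf i x - gf i y) \<le> L * norm (x - y)" "0 \<le> L"
  shows "(\<Sum>i\<in>UNIV. f i (sbar (Suc t))) \<le> (\<Sum>i\<in>UNIV. f i (sbar t))
    + \<gamma> t / real CARD('a) * (\<Sum>l\<in>UNIV. \<Sum>j\<in>UNIV. \<Phi> t j l * inner (gF (sbar t) $ l) (\<Delta> t j l))
    + real CARD('a) * L * (norm (sbar (Suc t) - sbar t))\<^sup>2"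
proof -
  have convex: "convex K"
    unfolding prod_set_def by (auto intro!: convexI convexD[OF K_convex])
  have deriv: "GDERIV (\<lambda>x. \<Sum>i\<in>UNIV. f i x) x :> gF x" if "x \<in> K" for x
    using f_deriv[OF that] unfolding gderiv_def gF_def inner_sum_right by (intro has_derivative_sum) auto
  have lip: "(real CARD('a) * L)-lipschitz_on K gF"
    using gF_lipschitz[OF L(1)] L(2) by (intro lipschitz_onI) (auto simp: dist_norm)
  have "inner (gF (sbar t)) (sbar (Suc t) - sbar t)
      = (\<Sum>l\<in>UNIV. inner (gF (sbar t) $ l) ((\<gamma> t / real CARD('a)) *\<^sub>R (\<Sum>j\<in>UNIV. \<Phi> t j l *\<^sub>R \<Delta> t j l)))"
    by (simp add: inner_vec_def sbar_Suc)
  also have "\<dots> = \<gamma> t / real CARD('a) * (\<Sum>l\<in>UNIV. \<Sum>j\<in>UNIV. \<Phi> t j l * inner (gF (sbar t) $ l) (\<Delta> t j l))"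
    by (simp add: inner_sum_right sum_distrib_left)
  finally show ?thesis
    using lipschitz_gradient_upper_bound[OF convex deriv lip sbar_in_K sbar_in_K, of "Suc t" t] by simp
qed

lemma lyapunov_descent:
  "\<exists>c>0. \<exists>e. summable e \<and> (\<forall>t. 0 \<le> e t) \<and>
    (\<forall>t. lyapunov (Suc t) \<le> lyapunov t - c * \<gamma> t * (\<Sum>l\<in>UNIV. \<Sum>j\<in>UNIV. (norm (\<Delta> t j l))\<^sup>2) + e t)"
proof -
  obtain L where L: "L \<ge> 0" "\<And>i x y. x \<in> K \<Longrightarrow> y \<in> K \<Longrightarrow> norm (gf i x - gf i y) \<le> L * norm (x - y)"
    using gf_lipschitz by blast
  obtain C where C: "C \<ge> 0" "\<And>t i l. norm (\<Delta> t i l) \<le> C" using \<Delta>_bounded by blast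
  obtain D where D: "D \<ge> 0" "\<And>t. norm (sbar (Suc t) - sbar t) \<le> D * \<gamma> t" using sbar_step by blast
  obtain \<phi> where \<phi>: "\<phi> > 0" "\<And>t i l. \<phi> \<le> \<Phi> t i l" using \<Phi>_lower by blast
  obtain \<mu> where \<mu>: "\<mu> > 0" "\<And>i. \<mu> \<le> \<tau> i" using uniform_positive_constant[of \<tau>] \<tau>_pos by blast
  obtain \<epsilon> where \<epsilon>: "summable (\<lambda>t. (\<epsilon> t)\<^sup>2)"
      "\<And>t j l. norm (real CARD('a) *\<^sub>R (Y t j $ l) - gF (sbar t) $ l) \<le> \<epsilon> t" using tracking by blast
  have \<epsilon>0: "0 \<le> \<epsilon> t" for t using order_trans[OF norm_ge_zero \<epsilon>(2)] .
  \<comment> \<open>The first term is the price of replacing the exact gradient by the trackers,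
    summable as a product of square-summable sequences; the second is the quadratic remainder of the
    smooth part.\<close>
  define e where "e t = real CARD('b) * C * (\<gamma> t * \<epsilon> t) + real CARD('a) * L * D\<^sup>2 * (\<gamma> t)\<^sup>2" for t
  define c where "c = \<phi> * \<mu> / real CARD('a)"
  have descent: "lyapunov (Suc t) \<le> lyapunov t - c * \<gamma> t * (\<Sum>l\<in>UNIV. \<Sum>j\<in>UNIV. (norm (\<Delta> t j l))\<^sup>2) + e t" for t
  proof -
    \<comment> \<open>The exact gradient is exchanged for the tracker at cost
      \<open>\<epsilon> t * C\<close>, after which \<open>\<Delta>_descent\<close> applies.\<close>
    have pointwise: "\<Phi> t j l * inner (gF (sbar t) $ l) (\<Delta> t j l)
        + \<Phi> t j l * (r l (X t j $ l + \<Delta> t j l) - r l (X t j $ l))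
        \<le> \<Phi> t j l * (\<epsilon> t * C) - \<phi> * \<mu> * (norm (\<Delta> t j l))\<^sup>2" for j l
    proof -
      have "- inner (real CARD('a) *\<^sub>R (Y t j $ l) - gF (sbar t) $ l) (\<Delta> t j l)
          \<le> norm (real CARD('a) *\<^sub>R (Y t j $ l) - gF (sbar t) $ l) * norm (\<Delta> t j l)"
        using Cauchy_Schwarz_ineq2[of "real CARD('a) *\<^sub>R (Y t j $ l) - gF (sbar t) $ l" "\<Delta> t j l"] by linarith
      also have "\<dots> \<le> \<epsilon> t * C" by (intro mult_mono \<epsilon> C \<epsilon>0 norm_ge_zero)
      finally have "inner (gF (sbar t) $ l) (\<Delta> t j l) + (r l (X t j $ l + \<Delta> t j l) - r l (X t j $ l))
          \<le> \<epsilon> t * C - \<tau> j * (norm (\<Delta> t j l))\<^sup>2"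
        using \<Delta>_descent[of t j l] by (simp add: inner_diff_left)
      then have "\<Phi> t j l * (inner (gF (sbar t) $ l) (\<Delta> t j l) + (r l (X t j $ l + \<Delta> t j l) - r l (X t j $ l)))
          \<le> \<Phi> t j l * (\<epsilon> t * C - \<tau> j * (norm (\<Delta> t j l))\<^sup>2)"
        using \<Phi>_pos[of t j l] by (intro mult_left_mono) auto
      moreover have "\<phi> * \<mu> * (norm (\<Delta> t j l))\<^sup>2 \<le> \<Phi> t j l * \<tau> j * (norm (\<Delta> t j l))\<^sup>2"
        using \<phi> \<mu> \<Phi>_pos[of t j l] by (intro mult_right_mono mult_mono) auto
      ultimately show ?thesis by (simp add: algebra_simps)
    qed
    define S1 where "S1 = (\<Sum>l\<in>UNIV. \<Sum>j\<in>UNIV. \<Phi> t j l * inner (gF (sbar t) $ l) (\<Delta> t j l))"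
    define S2 where "S2 = (\<Sum>l\<in>UNIV. \<Sum>j\<in>UNIV. \<Phi> t j l * (r l (X t j $ l + \<Delta> t j l) - r l (X t j $ l)))"
    define S3 where "S3 = (\<Sum>l\<in>UNIV. \<Sum>j\<in>UNIV. (norm (\<Delta> t j l))\<^sup>2)"
    have "S1 + S2 \<le> (\<Sum>l\<in>UNIV. \<Sum>j\<in>UNIV. \<Phi> t j l * (\<epsilon> t * C) - \<phi> * \<mu> * (norm (\<Delta> t j l))\<^sup>2)"
      unfolding S1_def S2_def sum.distrib[symmetric] by (intro sum_mono pointwise)
    also have "\<dots> = real CARD('b) * (real CARD('a) * (\<epsilon> t * C)) - \<phi> * \<mu> * S3"
      by (simp add: sum_subtractf S3_def \<Phi>_sum flip: sum_distrib_left sum_distrib_right)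
    finally have "\<gamma> t / real CARD('a) * (S1 + S2)
        \<le> \<gamma> t / real CARD('a) * (real CARD('b) * (real CARD('a) * (\<epsilon> t * C)) - \<phi> * \<mu> * S3)"
      using \<gamma>_pos[of t] by (intro mult_left_mono) auto
    also have "\<dots> = real CARD('b) * C * (\<gamma> t * \<epsilon> t) - c * \<gamma> t * S3"
      by (simp add: c_def field_simps)
    finally have 1: "\<gamma> t / real CARD('a) * (S1 + S2) \<le> real CARD('b) * C * (\<gamma> t * \<epsilon> t) - c * \<gamma> t * S3" .
    have 2: "(\<Sum>l\<in>UNIV. \<Sum>j\<in>UNIV. \<Phi> (Suc t) j l / real CARD('a) * r l (X (Suc t) j $ l))
      \<le> (\<Sum>l\<in>UNIV. \<Sum>j\<in>UNIV. \<Phi> t j l / real CARD('a) * r l (X t j $ l)) + \<gamma> t / real CARD('a) * S2"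
      unfolding S2_def sum_distrib_left[of "\<gamma> t / real CARD('a)" _ "UNIV :: 'b set"] sum.distrib[symmetric]
      by (intro sum_mono regularizer_descent)
    have 3: "(\<Sum>i\<in>UNIV. f i (sbar (Suc t))) \<le> (\<Sum>i\<in>UNIV. f i (sbar t)) + \<gamma> t / real CARD('a) * S1
        + real CARD('a) * L * (norm (sbar (Suc t) - sbar t))\<^sup>2"
      unfolding S1_def by (rule smooth_descent[OF L(2,1)])
    have "(norm (sbar (Suc t) - sbar t))\<^sup>2 \<le> (D * \<gamma> t)\<^sup>2" by (intro power_mono D norm_ge_zero)
    then have "real CARD('a) * L * (norm (sbar (Suc t) - sbar t))\<^sup>2 \<le> real CARD('a) * L * (D * \<gamma> t)\<^sup>2"
      using L(1) by (intro mult_left_mono) auto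
    then have 4: "real CARD('a) * L * (norm (sbar (Suc t) - sbar t))\<^sup>2 \<le> real CARD('a) * L * D\<^sup>2 * (\<gamma> t)\<^sup>2"
      by (simp add: power_mult_distrib mult.assoc)
    show ?thesis
      using 1 2 3 4 unfolding lyapunov_def e_def S3_def[symmetric] distrib_left by linarith
  qed
  have "0 < c" using \<phi> \<mu> by (simp add: c_def)
  moreover have "summable e"
    unfolding e_def by (intro summable_add summable_mult summable_mult_of_squares \<gamma>_sq_summable \<epsilon>)
  moreover have "0 \<le> e t" for t
    unfolding e_def using C L \<epsilon>0[of t] \<gamma>_pos[of t] by (intro add_nonneg_nonneg mult_nonneg_nonneg) auto
  ultimately show ?thesis using descent by blast
qed

lemma
  shows sbar_bounded: "bounded (range sbar)"
    and \<Delta>_weighted_summable: "summable (\<lambda>t. \<gamma> t * (norm (\<Delta> t j l))\<^sup>2)"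
proof -
  obtain m where m: "\<And>x. x \<in> K \<Longrightarrow> m \<le> U x" using U_bounded_below by blast
  obtain c e where c: "c > 0" and e: "summable e" "\<And>t. 0 \<le> e t"
    and desc: "\<And>t. lyapunov (Suc t) \<le> lyapunov t - c * \<gamma> t * (\<Sum>l\<in>UNIV. \<Sum>j\<in>UNIV. (norm (\<Delta> t j l))\<^sup>2) + e t"
    using lyapunov_descent by blast
  have lb: "m \<le> lyapunov t" for t using m[OF sbar_in_K] U_le_lyapunov order_trans by blast
  have w: "0 \<le> c * \<gamma> t * (\<Sum>l\<in>UNIV. \<Sum>j\<in>UNIV. (norm (\<Delta> t j l))\<^sup>2)" for t
    using c \<gamma>_pos[of t] by (intro mult_nonneg_nonneg sum_nonneg) auto
  note * = summable_of_descent[OF desc lb e w]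
  have "coercive_on K U" using U_coercive by (simp add: U_def[abs_def])
  \<comment> \<open>The added 1 makes the level strictly larger than every value of
    \<open>lyapunov\<close>, so no average can reach norm \<open>R\<close>.\<close>
  then obtain R where R: "\<And>x. x \<in> K \<Longrightarrow> R \<le> norm x \<Longrightarrow> lyapunov 0 + suminf e + 1 \<le> U x"
    by (meson coercive_on_def)
  have "norm (sbar t) \<le> R" for t
    using R[OF sbar_in_K, of t] *(2)[of t] U_le_lyapunov[of t] by linarith
  then show "bounded (range sbar)" by (auto simp: bounded_iff)
  show "summable (\<lambda>t. \<gamma> t * (norm (\<Delta> t j l))\<^sup>2)"
  proof (rule summable_comparison_test')
    show "summable (\<lambda>t. 1 / c * (c * \<gamma> t * (\<Sum>l\<in>UNIV. \<Sum>j\<in>UNIV. (norm (\<Delta> t j l))\<^sup>2)))"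
      by (intro summable_mult *(1))
    fix t
    have "(norm (\<Delta> t j l))\<^sup>2 \<le> (\<Sum>j\<in>UNIV. (norm (\<Delta> t j l))\<^sup>2)"
      by (rule member_le_sum[of j UNIV "\<lambda>j. (norm (\<Delta> t j l))\<^sup>2"]) auto
    also have "\<dots> \<le> (\<Sum>l\<in>UNIV. \<Sum>j\<in>UNIV. (norm (\<Delta> t j l))\<^sup>2)"
      by (rule member_le_sum[of l UNIV "\<lambda>l. \<Sum>j\<in>UNIV. (norm (\<Delta> t j l))\<^sup>2"]) (auto intro: sum_nonneg)
    finally show "norm (\<gamma> t * (norm (\<Delta> t j l))\<^sup>2)
        \<le> 1 / c * (c * \<gamma> t * (\<Sum>l\<in>UNIV. \<Sum>j\<in>UNIV. (norm (\<Delta> t j l))\<^sup>2))"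
      using c \<gamma>_pos[of t] by simp
  qed
qed

subsection \<open>Stationarity of limit points\<close>

text \<open>The agent's subproblem with the exact total gradient in place of the scaled tracker. It
  depends on neither time nor selection, so it can be evaluated for any block at any point of
  \<open>K\<close>.\<close>

definition response :: "'a \<Rightarrow> 'b \<Rightarrow> real^'d^'b \<Rightarrow> real^'d" where
  "response i l w = (SOME z. best_response i l w (gF w $ l - gf i w $ l) z)"

definition residual :: "'a \<Rightarrow> 'b \<Rightarrow> real^'d^'b \<Rightarrow> real^'d" where
  "residual i l w = response i l w - w $ l"

lemma response_best_response: "w \<in> K \<Longrightarrow> best_response i l w (gF w $ l - gf i w $ l) (response i l w)"
  unfolding response_def by (rule someI_ex[OF best_response_exists])

lemma residual_lipschitz:
  "\<exists>M\<ge>0. \<forall>i l. \<forall>w\<in>K. \<forall>w'\<in>K. norm (residual i l w - residual i l w') \<le> M * norm (w - w')"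
proof -
  obtain L where L: "L \<ge> 0" "\<And>i x y. x \<in> K \<Longrightarrow> y \<in> K \<Longrightarrow> norm (gf i x - gf i y) \<le> L * norm (x - y)"
    using gf_lipschitz by blast
  obtain Lt where Lt: "Lt \<ge> 0"
      "\<And>i l z x y. z \<in> Kb l \<Longrightarrow> x \<in> K \<Longrightarrow> y \<in> K \<Longrightarrow> norm (gft i l z x - gft i l z y) \<le> Lt * norm (x - y)"
    using ft_lipschitz by blast
  obtain \<mu> where \<mu>: "\<mu> > 0" "\<And>i. \<mu> \<le> \<tau> i" using uniform_positive_constant[of \<tau>] \<tau>_pos by blast
  \<comment> \<open>The quotient bounds the variation of the response, through its surrogate
    gradient and its linear term; the final 1 accounts for the subtracted block
    \<open>w $ l\<close>.\<close>
  define M where "M = (Lt + (real CARD('a) * L + L)) / \<mu> + 1"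
  have "norm (residual i l w - residual i l w') \<le> M * norm (w - w')" if w: "w \<in> K" "w' \<in> K" for i l w w'
  proof -
    let ?q = "\<lambda>w. gF w $ l - gf i w $ l" and ?d = "norm (w - w')"
    have "\<tau> i * norm (response i l w - response i l w') \<le> Lt * ?d + norm (?q w - ?q w')"
      using w by (intro best_response_perturbation[where l = l] Lt response_best_response)
    also have "norm (?q w - ?q w') \<le> real CARD('a) * L * ?d + L * ?d"
    proof -
      have "?q w - ?q w' = (gF w - gF w') $ l - (gf i w - gf i w') $ l" by simp
      also have "norm \<dots> \<le> real CARD('a) * L * ?d + L * ?d"
      proof (intro norm_triangle_le_diff add_mono)
        show "norm ((gF w - gF w') $ l) \<le> real CARD('a) * L * ?d"
          by (rule order_trans[OF Finite_Cartesian_Product.norm_nth_le gF_lipschitz]) (use L w in auto)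
        show "norm ((gf i w - gf i w') $ l) \<le> L * ?d"
          by (rule order_trans[OF Finite_Cartesian_Product.norm_nth_le L(2)[OF w]])
      qed
      finally show ?thesis .
    qed
    finally have "\<tau> i * norm (response i l w - response i l w') \<le> (Lt + (real CARD('a) * L + L)) * ?d"
      by (simp add: algebra_simps)
    moreover have "\<mu> * norm (response i l w - response i l w') \<le> \<tau> i * norm (response i l w - response i l w')"
      by (intro mult_right_mono \<mu>) simp
    ultimately have "norm (response i l w - response i l w') \<le> (Lt + (real CARD('a) * L + L)) / \<mu> * ?d"
      using \<mu>(1) by (simp add: pos_le_divide_eq mult.commute)
    moreover have "norm ((w - w') $ l) \<le> ?d" by (rule Finite_Cartesian_Product.norm_nth_le)
    moreover have "residual i l w - residual i l w' = (response i l w - response i l w') - (w - w') $ l"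
      by (simp add: residual_def)
    ultimately have "norm (residual i l w - residual i l w') \<le> (Lt + (real CARD('a) * L + L)) / \<mu> * ?d + ?d"
      using norm_triangle_ineq4[of "response i l w - response i l w'" "(w - w') $ l"] by simp
    then show ?thesis by (simp add: M_def distrib_right)
  qed
  moreover have "0 \<le> M" using L Lt \<mu> by (simp add: M_def)
  ultimately show ?thesis by blast
qed

text \<open>For the selected block the computed \<open>Xt\<close> and the exact response solve
  neighbouring subproblems, with data \<open>X t i\<close> and the tracker against
  \<open>sbar t\<close> and \<open>gF\<close>. \<open>best_response_perturbation\<close> bounds
  their distance by disagreement and tracking error.\<close>

lemma residual_selected_block:
  "\<exists>e. summable (\<lambda>t. (e t)\<^sup>2) \<and> (\<forall>t i. norm (residual i (sel t i) (sbar t)) \<le> norm (\<Delta> t i (sel t i)) + e t)"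
proof -
  obtain L where L: "L \<ge> 0" "\<And>i x y. x \<in> K \<Longrightarrow> y \<in> K \<Longrightarrow> norm (gf i x - gf i y) \<le> L * norm (x - y)"
    using gf_lipschitz by blast
  obtain Lt where Lt: "Lt \<ge> 0"
      "\<And>i l z x y. z \<in> Kb l \<Longrightarrow> x \<in> K \<Longrightarrow> y \<in> K \<Longrightarrow> norm (gft i l z x - gft i l z y) \<le> Lt * norm (x - y)"
    using ft_lipschitz by blast
  obtain \<mu> where \<mu>: "\<mu> > 0" "\<And>i. \<mu> \<le> \<tau> i" using uniform_positive_constant[of \<tau>] \<tau>_pos by blast
  obtain \<epsilon> where \<epsilon>: "summable (\<lambda>t. (\<epsilon> t)\<^sup>2)"
      "\<And>t j l. norm (real CARD('a) *\<^sub>R (Y t j $ l) - gF (sbar t) $ l) \<le> \<epsilon> t" using tracking by blast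
  define e where "e t = 1 / \<mu> * ((Lt + L) * disagreement t + \<epsilon> t) + disagreement t" for t
  have "summable (\<lambda>t. (e t)\<^sup>2)"
    unfolding e_def by (intro square_summable_add square_summable_cmult disagreement_square_summable \<epsilon>)
  moreover have "norm (residual i (sel t i) (sbar t)) \<le> norm (\<Delta> t i (sel t i)) + e t" for t i
  proof -
    define l where "l = sel t i"
    let ?z = "response i l (sbar t)" and ?d = "disagreement t"
    let ?q = "gF (sbar t) $ l - gf i (sbar t) $ l" and ?p = "real CARD('a) *\<^sub>R (Y t i $ l) - gf i (X t i) $ l"
    have "\<tau> i * norm (Xt t i - ?z) \<le> Lt * norm (X t i - sbar t) + norm (?p - ?q)"
      by (intro best_response_perturbation[where l = l] Lt response_best_response X_in_K sbar_in_K)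
        (auto simp: l_def best_response_Xt)
    also have "Lt * norm (X t i - sbar t) \<le> Lt * ?d" by (intro mult_left_mono X_sbar Lt)
    also have "norm (?p - ?q) \<le> \<epsilon> t + L * ?d"
    proof -
      have "norm ((gf i (X t i) - gf i (sbar t)) $ l) \<le> norm (gf i (X t i) - gf i (sbar t))"
        by (rule Finite_Cartesian_Product.norm_nth_le)
      also have "\<dots> \<le> L * norm (X t i - sbar t)" by (intro L X_in_K sbar_in_K)
      also have "\<dots> \<le> L * ?d" by (intro mult_left_mono X_sbar L)
      finally have "norm ((real CARD('a) *\<^sub>R (Y t i $ l) - gF (sbar t) $ l) - (gf i (X t i) - gf i (sbar t)) $ l)
          \<le> \<epsilon> t + L * ?d"
        by (intro norm_triangle_le_diff add_mono \<epsilon>(2))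
      then show ?thesis by (simp add: algebra_simps)
    qed
    finally have "\<tau> i * norm (Xt t i - ?z) \<le> (Lt + L) * ?d + \<epsilon> t" by (simp add: algebra_simps)
    moreover have "\<mu> * norm (Xt t i - ?z) \<le> \<tau> i * norm (Xt t i - ?z)"
      by (intro mult_right_mono \<mu>) simp
    ultimately have 1: "norm (Xt t i - ?z) \<le> 1 / \<mu> * ((Lt + L) * ?d + \<epsilon> t)"
      using \<mu>(1) by (simp add: pos_le_divide_eq mult.commute)
    have 2: "norm ((X t i - sbar t) $ l) \<le> ?d"
      by (rule order_trans[OF Finite_Cartesian_Product.norm_nth_le X_sbar])
    have "residual i l (sbar t) = \<Delta> t i l - (Xt t i - ?z) + (X t i - sbar t) $ l"
      by (simp add: residual_def \<Delta>_def l_def)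
    then have "norm (residual i l (sbar t)) \<le> norm (\<Delta> t i l) + norm (Xt t i - ?z) + norm ((X t i - sbar t) $ l)"
      using norm_triangle_ineq[of "\<Delta> t i l - (Xt t i - ?z)" "(X t i - sbar t) $ l"]
        norm_triangle_ineq4[of "\<Delta> t i l" "Xt t i - ?z"] by simp
    then show ?thesis using 1 2 by (simp add: e_def l_def)
  qed
  ultimately show ?thesis by blast
qed

lemma \<gamma>_antimono: "s \<le> t \<Longrightarrow> \<gamma> t \<le> \<gamma> s"
  by (rule lift_Suc_antimono_le[of \<gamma>]) (simp_all add: \<gamma>_decr)

lemma sbar_drift:
  assumes D: "\<And>t. norm (sbar (Suc t) - sbar t) \<le> D * \<gamma> t" "0 \<le> D"
  shows "norm (sbar (t + k) - sbar t) \<le> real k * D * \<gamma> t"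
proof (induction k)
  case (Suc k)
  have "D * \<gamma> (t + k) \<le> D * \<gamma> t" using D by (intro mult_left_mono \<gamma>_antimono) auto
  then have "norm (sbar (t + Suc k) - sbar (t + k)) \<le> D * \<gamma> t"
    using D(1)[of "t + k"] by simp
  moreover have "norm (sbar (t + Suc k) - sbar t)
      \<le> norm (sbar (t + Suc k) - sbar (t + k)) + norm (sbar (t + k) - sbar t)"
    using norm_triangle_ineq[of "sbar (t + Suc k) - sbar (t + k)" "sbar (t + k) - sbar t"] by simp
  ultimately show ?case using Suc by (simp add: algebra_simps)
qed simp

text \<open>At the times when agent \<open>i\<close> selects \<open>l\<close> the residual is
  controlled by \<open>\<Delta>\<close>. Any other time is compared with a selection time at most
  one window earlier; the average drifts only by a multiple of \<open>\<gamma> t\<close> meanwhile,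
  and the squared drift is summable.\<close>

lemma residual_weighted_summable: "summable (\<lambda>t. \<gamma> t * (norm (residual i l (sbar t)))\<^sup>2)"
proof -
  obtain M where M: "M \<ge> 0"
      "\<And>i l w w'. w \<in> K \<Longrightarrow> w' \<in> K \<Longrightarrow> norm (residual i l w - residual i l w') \<le> M * norm (w - w')"
    using residual_lipschitz by blast
  obtain e where e: "summable (\<lambda>t. (e t)\<^sup>2)"
      "\<And>t i. norm (residual i (sel t i) (sbar t)) \<le> norm (\<Delta> t i (sel t i)) + e t"
    using residual_selected_block by blast
  obtain D where D: "D \<ge> 0" "\<And>t. norm (sbar (Suc t) - sbar t) \<le> D * \<gamma> t" using sbar_step by blast
  obtain T where T: "\<And>t i l. \<exists>s<T. sel (t + s) i = l" using common_window by blast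
  define \<rho> where "\<rho> t = norm (residual i l (sbar t))" for t
  define S where "S t = (if sel t i = l then \<gamma> t * (\<rho> t)\<^sup>2 else 0)" for t
  have square_add: "(x + y)\<^sup>2 \<le> 2 * x\<^sup>2 + 2 * y\<^sup>2" for x y :: real
    using zero_le_power2[of "x - y"] by (simp add: power2_sum power2_diff)
  have S_nonneg: "0 \<le> S t" for t using \<gamma>_pos[of t] by (simp add: S_def)
  have "summable S"
  proof (rule summable_comparison_test')
    show "summable (\<lambda>t. 2 * (\<gamma> t * (norm (\<Delta> t i l))\<^sup>2) + 2 * (e t)\<^sup>2)"
      by (intro summable_add summable_mult \<Delta>_weighted_summable e)
    show "norm (S t) \<le> 2 * (\<gamma> t * (norm (\<Delta> t i l))\<^sup>2) + 2 * (e t)\<^sup>2" for t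
    proof (cases "sel t i = l")
      case True
      have "(\<rho> t)\<^sup>2 \<le> (norm (\<Delta> t i l) + e t)\<^sup>2"
        using e(2)[of i t] True by (intro power_mono) (auto simp: \<rho>_def)
      also note square_add
      finally have "\<gamma> t * (\<rho> t)\<^sup>2 \<le> \<gamma> t * (2 * (norm (\<Delta> t i l))\<^sup>2 + 2 * (e t)\<^sup>2)"
        using \<gamma>_pos[of t] by (intro mult_left_mono) auto
      moreover have "\<gamma> t * (e t)\<^sup>2 \<le> 1 * (e t)\<^sup>2" by (intro mult_right_mono \<gamma>_le1) simp
      ultimately have "\<gamma> t * (\<rho> t)\<^sup>2 \<le> 2 * (\<gamma> t * (norm (\<Delta> t i l))\<^sup>2) + 2 * (e t)\<^sup>2"
        by (simp add: algebra_simps)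
      then show ?thesis using True \<gamma>_pos[of t] by (simp add: S_def)
    next
      case False then show ?thesis using \<gamma>_pos[of t] by (simp add: S_def)
    qed
  qed
  have "summable (\<lambda>t. \<gamma> (t + T) * (\<rho> (t + T))\<^sup>2)"
  proof (rule summable_comparison_test')
    show "summable (\<lambda>t. 2 * (\<Sum>s<T. S (t + s)) + 2 * (M * T * D)\<^sup>2 * (\<gamma> t)\<^sup>2)"
      using \<open>summable S\<close>
      by (intro summable_add summable_mult summable_sum summable_ignore_initial_segment \<gamma>_sq_summable)
    fix t
    obtain s where s: "s < T" "sel (t + s) i = l" using T by blast
    let ?g = "\<gamma> (t + T)"
    \<comment> \<open>Monotone step sizes let weight be exchanged only towards earlier times, so the
      residual is taken at the end of the window, after the selection.\<close>
    have g: "0 < ?g" "?g \<le> 1" "?g \<le> \<gamma> (t + s)" using \<gamma>_pos \<gamma>_le1 \<gamma>_antimono s by auto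
    have "norm (sbar (t + s + (T - s)) - sbar (t + s)) \<le> real (T - s) * D * \<gamma> (t + s)"
      by (rule sbar_drift[OF D(2,1)])
    also have "\<dots> \<le> real T * D * \<gamma> t"
      using D(1) \<gamma>_antimono[of t "t + s"] \<gamma>_pos[of "t + s"] by (intro mult_mono) auto
    finally have "M * norm (sbar (t + T) - sbar (t + s)) \<le> M * (T * D * \<gamma> t)"
      using M(1) s by (intro mult_left_mono) auto
    then have "norm (residual i l (sbar (t + T)) - residual i l (sbar (t + s))) \<le> M * T * D * \<gamma> t"
      using M(2)[OF sbar_in_K sbar_in_K, of i l "t + T" "t + s"] by (simp add: mult.assoc)
    then have "\<rho> (t + T) \<le> \<rho> (t + s) + M * T * D * \<gamma> t"
      unfolding \<rho>_def using norm_triangle_sub[of "residual i l (sbar (t + T))" "residual i l (sbar (t + s))"]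
      by linarith
    then have "(\<rho> (t + T))\<^sup>2 \<le> (\<rho> (t + s) + M * T * D * \<gamma> t)\<^sup>2"
      by (intro power_mono) (auto simp: \<rho>_def)
    also note square_add
    finally have "?g * (\<rho> (t + T))\<^sup>2 \<le> ?g * (2 * (\<rho> (t + s))\<^sup>2 + 2 * (M * T * D * \<gamma> t)\<^sup>2)"
      using g by (intro mult_left_mono) auto
    also have "\<dots> = 2 * (?g * (\<rho> (t + s))\<^sup>2) + ?g * (2 * (M * T * D * \<gamma> t)\<^sup>2)"
      by (simp add: distrib_left)
    also have "\<dots> \<le> 2 * S (t + s) + 1 * (2 * (M * T * D * \<gamma> t)\<^sup>2)"
      using g s(2) by (intro add_mono mult_right_mono mult_left_mono) (auto simp: S_def intro: mult_right_mono)
    \<comment> \<open>The selection time \<open>s\<close> depends on \<open>t\<close>; the whole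
      window is a fixed sum of \<open>T\<close> shifted summable series.\<close>
    also have "S (t + s) \<le> (\<Sum>s<T. S (t + s))"
      by (rule member_le_sum[of s "{..<T}" "\<lambda>s. S (t + s)"]) (use s S_nonneg in auto)
    finally show "norm (?g * (\<rho> (t + T))\<^sup>2) \<le> 2 * (\<Sum>s<T. S (t + s)) + 2 * (M * T * D)\<^sup>2 * (\<gamma> t)\<^sup>2"
      using g by (simp add: power_mult_distrib)
  qed
  then show ?thesis
    unfolding \<rho>_def by (subst (asm) summable_iff_shift)
qed

lemma residual_tendsto_zero: "(\<lambda>t. norm (residual i l (sbar t))) \<longlonglongrightarrow> 0"
proof -
  obtain M where M: "M \<ge> 0"
      "\<And>i l w w'. w \<in> K \<Longrightarrow> w' \<in> K \<Longrightarrow> norm (residual i l w - residual i l w') \<le> M * norm (w - w')"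
    using residual_lipschitz by blast
  obtain D where D: "D \<ge> 0" "\<And>t. norm (sbar (Suc t) - sbar t) \<le> D * \<gamma> t" using sbar_step by blast
  show ?thesis
  proof (rule tendsto_zero_of_weighted_square_summable[where \<gamma> = \<gamma> and M = "M * D"])
    fix t
    have "\<bar>norm (residual i l (sbar (Suc t))) - norm (residual i l (sbar t))\<bar>
        \<le> norm (residual i l (sbar (Suc t)) - residual i l (sbar t))"
      by (rule norm_triangle_ineq3)
    also have "\<dots> \<le> M * norm (sbar (Suc t) - sbar t)" by (intro M sbar_in_K)
    also have "\<dots> \<le> M * (D * \<gamma> t)" by (intro mult_left_mono D M)
    finally show "\<bar>norm (residual i l (sbar (Suc t))) - norm (residual i l (sbar t))\<bar> \<le> M * D * \<gamma> t"
      by (simp add: mult.assoc)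
  qed (use \<gamma>_pos \<gamma>_le1 \<gamma>_not_summable \<gamma>_sq_summable residual_weighted_summable in \<open>auto simp: less_imp_le\<close>)
qed

text \<open>The agent \<open>i\<close> is fixed: if the response returns the point itself, gradient
  consistency cancels \<open>gf i\<close> against the linear term and leaves the total gradient. The
  inequality then holds block by block, hence for the sum.\<close>

lemma stationary_of_residual_zero:
  assumes x: "x \<in> K" and zero: "\<And>l. residual i l x = 0"
  shows "stationary gf r Kb x"
  unfolding stationary_def
proof (intro conjI ballI x sum_nonneg)
  fix y l assume y: "y \<in> K"
  have "response i l x = x $ l" using zero[of l] by (simp add: residual_def)
  then have "best_response i l x (gF x $ l - gf i x $ l) (x $ l)" using response_best_response[OF x] by metis
  then show "0 \<le> inner (\<Sum>i\<in>UNIV. gf i x $ l) (y $ l - x $ l) + r l (y $ l) - r l (x $ l)"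
    using y by (simp add: best_response_def ft_grad_cons[OF x] gF_def prod_set_def)
qed

lemma limit_point_stationary:
  assumes \<sigma>: "strict_mono \<sigma>" "(sbar \<circ> \<sigma>) \<longlonglongrightarrow> x"
  shows "stationary gf r Kb x"
proof -
  obtain M where M: "M \<ge> 0"
      "\<And>i l w w'. w \<in> K \<Longrightarrow> w' \<in> K \<Longrightarrow> norm (residual i l w - residual i l w') \<le> M * norm (w - w')"
    using residual_lipschitz by blast
  have x: "x \<in> K"
    by (rule closed_sequentially[OF closed_K _ \<sigma>(2)]) (simp add: sbar_in_K)
  have "norm (residual i l x) \<le> 0" for i l
  proof (rule LIMSEQ_le_const)
    have "(\<lambda>n. norm (x - sbar (\<sigma> n))) \<longlonglongrightarrow> norm (x - x)"
      using \<sigma>(2) unfolding comp_def by (intro tendsto_intros)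
    then have "(\<lambda>n. norm (x - sbar (\<sigma> n))) \<longlonglongrightarrow> 0" by simp
    moreover have "(\<lambda>n. norm (residual i l (sbar (\<sigma> n)))) \<longlonglongrightarrow> 0"
      using LIMSEQ_subseq_LIMSEQ[OF residual_tendsto_zero \<sigma>(1)] by (simp add: comp_def)
    ultimately show "(\<lambda>n. norm (residual i l (sbar (\<sigma> n))) + M * norm (x - sbar (\<sigma> n))) \<longlonglongrightarrow> 0"
      by (intro tendsto_add_zero tendsto_mult_right_zero)
    have "norm (residual i l x) \<le> norm (residual i l (sbar (\<sigma> n))) + M * norm (x - sbar (\<sigma> n))" for n
      using norm_triangle_sub[of "residual i l x" "residual i l (sbar (\<sigma> n))"] M(2)[OF x sbar_in_K, of i l "\<sigma> n"]
      by linarith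
    then show "\<exists>N. \<forall>n\<ge>N. norm (residual i l x) \<le> norm (residual i l (sbar (\<sigma> n))) + M * norm (x - sbar (\<sigma> n))"
      by blast
  qed
  then show ?thesis using x by (intro stationary_of_residual_zero) auto
qed

lemma consensus: "(\<lambda>t. norm (X t i - sbar t)) \<longlonglongrightarrow> 0"
  by (rule Lim_null_comparison[OF _ tendsto_zero_of_square_summable[OF disagreement_square_summable]])
    (simp add: X_sbar)

end

theorem theorem1:
  fixes f :: "'a::finite \<Rightarrow> real^'d::finite^'b::finite \<Rightarrow> real"
    and gf :: "'a \<Rightarrow> real^'d^'b \<Rightarrow> real^'d^'b"
    and r :: "'b \<Rightarrow> real^'d \<Rightarrow> real"
    and Kb :: "'b \<Rightarrow> (real^'d) set"
    and E :: "('a \<times> 'a) set"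
    and sel :: "nat \<Rightarrow> 'a \<Rightarrow> 'b"
    and A :: "'b \<Rightarrow> nat \<Rightarrow> 'a \<Rightarrow> 'a \<Rightarrow> real"
    and \<kappa> :: real
    and ft :: "'a \<Rightarrow> 'b \<Rightarrow> real^'d \<Rightarrow> real^'d^'b \<Rightarrow> real"
    and gft :: "'a \<Rightarrow> 'b \<Rightarrow> real^'d \<Rightarrow> real^'d^'b \<Rightarrow> real^'d"
    and \<tau> :: "'a \<Rightarrow> real"
    and \<gamma> :: "nat \<Rightarrow> real"
    and X Y :: "nat \<Rightarrow> 'a \<Rightarrow> real^'d^'b"
    and \<Phi> :: "nat \<Rightarrow> 'a \<Rightarrow> 'b \<Rightarrow> real"
    and Xt :: "nat \<Rightarrow> 'a \<Rightarrow> real^'d"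
  defines "K \<equiv> prod_set Kb"
    and "U \<equiv> (\<lambda>x. (\<Sum>i\<in>UNIV. f i x) + (\<Sum>l\<in>UNIV. r l (x $ l)))"
    and "fhat \<equiv> (\<lambda>i l z w g. ft i l z w + inner (real CARD('a) *\<^sub>R g - gf i w $ l) (z - w $ l))"
    and "sbar \<equiv> (\<lambda>t. (1 / real CARD('a)) *\<^sub>R (\<chi> l. \<Sum>i\<in>UNIV. \<Phi> t i l *\<^sub>R (X t i $ l)))"
  \<comment> \<open>problem assumptions\<close>
  assumes K_ne: "\<And>l. Kb l \<noteq> {}"
    and K_closed: "\<And>l. closed (Kb l)"
    and K_convex: "\<And>l. convex (Kb l)"
    and f_C1: "\<exists>S. open S \<and> K \<subseteq> S \<and>
                 (\<forall>i. (\<forall>x\<in>S. GDERIV (f i) x :> gf i x) \<and> continuous_on S (gf i))"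
    and gf_lip: "\<And>i. \<exists>L. L-lipschitz_on K (gf i)"
    and gf_bdd: "\<And>i. bounded (gf i ` K)"
    and r_convex: "\<And>l. convex_on UNIV (r l)"
    and r_subgrad_bdd: "\<And>l. \<exists>M. \<forall>z\<in>Kb l. \<forall>g. is_subgradient (r l) z g \<longrightarrow> norm g \<le> M"
    and U_coercive: "coercive_on K U"
  \<comment> \<open>network\<close>
    and E_strong: "\<And>i j. (i, j) \<in> E\<^sup>*"
    and E_loops: "\<And>i. (i, i) \<in> E"
  \<comment> \<open>block selection\<close>
    and sel_ess_cyclic: "\<And>i. \<exists>T>0. \<forall>t. (\<Union>s<T. {sel (t + s) i}) = UNIV"
  \<comment> \<open>weights\<close>
    and \<kappa>_pos: "\<kappa> > 0"
    and A_pos: "\<And>l t i j. (j, i) \<in> edges_block E (sel t) l \<Longrightarrow> A l t i j > \<kappa>"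
    and A_zero: "\<And>l t i j. (j, i) \<notin> edges_block E (sel t) l \<Longrightarrow> A l t i j = 0"
    and A_colstoch: "\<And>l t j. (\<Sum>i\<in>UNIV. A l t i j) = 1"
  \<comment> \<open>surrogates\<close>
    and \<tau>_pos: "\<And>i. \<tau> i > 0"
    and ft_deriv: "\<And>i l x z. x \<in> K \<Longrightarrow> z \<in> Kb l \<Longrightarrow> GDERIV (\<lambda>z. ft i l z x) z :> gft i l z x"
    and ft_C1: "\<And>i l x. x \<in> K \<Longrightarrow> continuous_on (Kb l) (\<lambda>z. gft i l z x)"
    and ft_strong: "\<And>i l x. x \<in> K \<Longrightarrow> strongly_convex_on (\<tau> i) (Kb l) (\<lambda>z. ft i l z x)"
    and ft_grad_cons: "\<And>i l x. x \<in> K \<Longrightarrow> gft i l (x $ l) x = gf i x $ l"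
    and ft_lip: "\<And>i l. \<exists>L. \<forall>z\<in>Kb l. L-lipschitz_on K (\<lambda>x. gft i l z x)"
  \<comment> \<open>step sizes\<close>
    and \<gamma>_pos: "\<And>t. 0 < \<gamma> t" and \<gamma>_le1: "\<And>t. \<gamma> t \<le> 1"
    and \<gamma>_decr: "\<And>t. \<gamma> (Suc t) \<le> \<gamma> t"
    and \<gamma>_not_summable: "\<not> summable \<gamma>"
    and \<gamma>_sq_summable: "summable (\<lambda>t. (\<gamma> t)\<^sup>2)"
  \<comment> \<open>the algorithm\<close>
    and init_X: "\<And>i. X 0 i \<in> K"
    and init_Y: "\<And>i. Y 0 i = gf i (X 0 i)"
    and init_\<Phi>: "\<And>i l. \<Phi> 0 i l = 1"
    and Xt_mem: "\<And>t i. Xt t i \<in> Kb (sel t i)"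
    and Xt_min: "\<And>t i z. z \<in> Kb (sel t i) \<Longrightarrow>
        fhat i (sel t i) (Xt t i) (X t i) (Y t i $ sel t i) + r (sel t i) (Xt t i)
          \<le> fhat i (sel t i) z (X t i) (Y t i $ sel t i) + r (sel t i) z"
    and upd_\<Phi>: "\<And>t i l. \<Phi> (Suc t) i l =
        (\<Sum>j\<in>nbr_block E (sel t) i l. A l t i j * \<Phi> t j l)"
    and upd_X: "\<And>t i l. X (Suc t) i $ l =
        (\<Sum>j\<in>nbr_block E (sel t) i l. (A l t i j * \<Phi> t j l / \<Phi> (Suc t) i l) *\<^sub>R
           (X t j $ l + \<gamma> t *\<^sub>R (if l = sel t j then Xt t j - X t j $ l else 0)))"
    and upd_Y: "\<And>t i l. Y (Suc t) i $ l =
        (\<Sum>j\<in>nbr_block E (sel t) i l. (A l t i j / \<Phi> (Suc t) i l) *\<^sub>R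
           (\<Phi> t j l *\<^sub>R (Y t j $ l) + gf j (X (Suc t) j) $ l - gf j (X t j) $ l))"
  shows "(\<forall>i. (\<lambda>t. norm (X t i - sbar t)) \<longlonglongrightarrow> 0)
       \<and> bounded (range sbar)
       \<and> (\<forall>xs. (\<exists>\<sigma>. strict_mono \<sigma> \<and> (sbar \<circ> \<sigma>) \<longlonglongrightarrow> xs) \<longrightarrow> stationary gf r Kb xs)"
proof -
  obtain S where S: "K \<subseteq> S" "\<And>i x. x \<in> S \<Longrightarrow> GDERIV (f i) x :> gf i x" using f_C1 by blast
  interpret alg: block_gradient_tracking f gf r Kb E sel A \<kappa> ft gft \<tau> \<gamma> X Y \<Phi> Xt
  proof (unfold_locales, fold K_def)
    show "GDERIV (f i) x :> gf i x" if "x \<in> K" for i x using S that by blast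
    show "coercive_on K (\<lambda>x. (\<Sum>i\<in>UNIV. f i x) + (\<Sum>l\<in>UNIV. r l (x $ l)))"
      using U_coercive by (simp add: U_def)
    show "ft i (sel t i) (Xt t i) (X t i)
          + inner (real CARD('a) *\<^sub>R (Y t i $ sel t i) - gf i (X t i) $ sel t i) (Xt t i - X t i $ sel t i)
          + r (sel t i) (Xt t i)
        \<le> ft i (sel t i) z (X t i)
          + inner (real CARD('a) *\<^sub>R (Y t i $ sel t i) - gf i (X t i) $ sel t i) (z - X t i $ sel t i)
          + r (sel t i) z" if "z \<in> Kb (sel t i)" for t i z
      using Xt_min[OF that] by (simp add: fhat_def)
  qed (fact K_ne K_closed K_convex gf_lip gf_bdd r_convex r_subgrad_bdd E_strong E_loops
      sel_ess_cyclic \<kappa>_pos A_pos A_zero A_colstoch \<tau>_pos ft_deriv ft_strong ft_grad_cons ft_lip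
      \<gamma>_pos \<gamma>_le1 \<gamma>_decr \<gamma>_not_summable \<gamma>_sq_summable init_X init_Y init_\<Phi> Xt_mem upd_\<Phi> upd_X upd_Y)+
  have "sbar = alg.sbar" by (simp add: fun_eq_iff sbar_def alg.sbar_def)
  then show ?thesis
    using alg.consensus alg.sbar_bounded alg.limit_point_stationary by auto
qed

end
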